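(* Let $n\ge1$, let $\theta$ be a real skew-symmetric $n\times n$ matrix, and let $k\in\mathbb{N}$ satisfy $k>n/2$. Then $H^k_\theta$ is a Banach algebra. More precisely, there exists a constant $A_{k,n}>0$, depending only on $k$ and $n$ (independent of $\theta$), such that $$\|ab\|_{H^k_\theta}\le A_{k,n}\|a\|_{H^k_\theta}\|b\|_{H^k_\theta},\qquad a,b\in H^k_\theta.$$
   Context: $\mathbb{N}=\{1,2,\dots\}$. Let $\theta=(\theta_{jk})$ be a real skew-symmetric $n\times n$ matrix. Let $U_1,\dots,U_n$ be unitaries with $U_kU_j=e^{2\pi i\theta_{kj}}U_jU_k$, realized in the standard representation on $\ell^2(\mathbb{Z}^n)$ (with canonical basis $(e_m)$): $U_je_m=e^{2\pi i\sum_{l<j}\theta_{jl}m_l}e_{m+\epsilon_j}$, where $\epsilon_j$ is the $j$-th unit vector. The noncommutative torus $\mathbb{T}_\theta^n=L^\infty(\mathbb{T}_\theta^n)$ is the von Neumann algebra they generate. For $m\in\mathbb{Z}^n$ put $U^m=U_1^{m_1}\cdots U_n^{m_n}$. The smooth algebra $\mathcal{A}_\theta^\infty$ is the set of all series $\sum_mc_mU^m$ with rapidly decreasing coefficients. The canonical trace $\tau$ is the faithful normal tracial state with $\tau(\sum c_mU^m)=c_0$ on $\mathcal{A}_\theta^\infty$. $L^2(\mathbb{T}_\theta^n)$ is the completion of $\mathcal{A}_\theta^\infty$ for $\|a\|_{L^2}=\tau(|a|^2)^{1/2}$; $\{U^m\}$ is an orthonormal basis of it, and $\widehat a(m)=\tau((U^m)^*a)$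 are the Fourier coefficients. For $s\ge0$, $H^s_\theta$ is the set of $a\in L^2(\mathbb{T}_\theta^n)$ with $\|a\|_{H^s_\theta}^2=\sum_{m\in\mathbb{Z}^n}(1+4\pi^2|m|^2)^s|\widehat a(m)|^2<\infty$, where $|m|^2=m_1^2+\cdots+m_n^2$. For $k>n/2$ one has $H^k_\theta\subset L^\infty(\mathbb{T}_\theta^n)$ (inside $L^2(\mathbb{T}_\theta^n)$), and $ab$ is the product in $L^\infty(\mathbb{T}_\theta^n)$. "Banach algebra" is meant with the submultiplicativity constant $A_{k,n}$ as displayed (not necessarily $1$). *)

theory Defs
  imports "HOL-Analysis.Analysis"
begin

section \<open>The Hilbert space of square-summable families\<close>

typedef 'a ell2 = "{f :: 'a \<Rightarrow> complex. (\<lambda>i. (cmod (f i))\<^sup>2) summable_on UNIV}"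
  morphisms coord Abs_ell2
  by (rule exI[of _ "\<lambda>_. 0"]) simp

setup_lifting type_definition_ell2

lemma ell2_summable: "(\<lambda>i. (cmod (coord x i))\<^sup>2) summable_on UNIV"
  using coord[of x] by simp

lemma ell2_eqI: "(\<And>i. coord x i = coord y i) \<Longrightarrow> x = y"
  by (simp add: coord_inject[symmetric] fun_eq_iff)

lemma summable_on_real_le:
  fixes f g :: "'a \<Rightarrow> real"
  assumes "g summable_on A" "\<And>i. i \<in> A \<Longrightarrow> 0 \<le> f i" "\<And>i. i \<in> A \<Longrightarrow> f i \<le> g i"
  shows "f summable_on A"
  by (rule summable_on_comparison_test[OF assms(1)]) (use assms in auto)

lemma cmod_add_sq_le: "(cmod (a + b))\<^sup>2 \<le> 2 * (cmod a)\<^sup>2 + 2 * (cmod b)\<^sup>2"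
proof -
  have "(cmod (a + b))\<^sup>2 \<le> (cmod a + cmod b)\<^sup>2"
    by (simp add: norm_triangle_ineq power_mono)
  also have "\<dots> \<le> 2 * (cmod a)\<^sup>2 + 2 * (cmod b)\<^sup>2"
    using sum_squares_bound[of "cmod a" "cmod b"] by (simp add: power2_sum)
  finally show ?thesis .
qed

instantiation ell2 :: (type) ab_group_add
begin
lift_definition zero_ell2 :: "'a ell2" is "\<lambda>_. 0" by simp
lift_definition plus_ell2 :: "'a ell2 \<Rightarrow> 'a ell2 \<Rightarrow> 'a ell2" is "\<lambda>f g i. f i + g i"
proof -
  fix f g :: "'a \<Rightarrow> complex"
  assume "(\<lambda>i. (cmod (f i))\<^sup>2) summable_on UNIV" "(\<lambda>i. (cmod (g i))\<^sup>2) summable_on UNIV"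
  then have "(\<lambda>i. 2 * (cmod (f i))\<^sup>2 + 2 * (cmod (g i))\<^sup>2) summable_on UNIV"
    by (intro summable_on_add summable_on_cmult_right)
  then show "(\<lambda>i. (cmod (f i + g i))\<^sup>2) summable_on UNIV"
    by (rule summable_on_real_le) (auto intro: cmod_add_sq_le)
qed
lift_definition uminus_ell2 :: "'a ell2 \<Rightarrow> 'a ell2" is "\<lambda>f i. - f i" by simp
definition minus_ell2 :: "'a ell2 \<Rightarrow> 'a ell2 \<Rightarrow> 'a ell2" where "minus_ell2 x y = x + - y"
instance
proof
  fix a b c :: "'a ell2"
  show "a + b + c = a + (b + c)" by transfer (simp add: algebra_simps)
  show "a + b = b + a" by transfer (simp add: algebra_simps)
  show "0 + a = a" by transfer simp
  show "- a + a = 0" by transfer simp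
  show "a - b = a + - b" by (rule minus_ell2_def)
qed
end

lift_definition scaleC :: "complex \<Rightarrow> 'a ell2 \<Rightarrow> 'a ell2"  (infixr "*\<^sub>C" 75)
  is "\<lambda>c f i. c * f i"
  by (simp add: norm_mult power_mult_distrib summable_on_cmult_right)

definition cinner :: "'a ell2 \<Rightarrow> 'a ell2 \<Rightarrow> complex" where
  "cinner x y = (\<Sum>\<^sub>\<infinity>i. cnj (coord x i) * coord y i)"

lemma cinner_summable: "(\<lambda>i. cnj (coord x i) * coord y i) summable_on UNIV"
proof (rule abs_summable_summable)
  have "(\<lambda>i. (cmod (coord x i))\<^sup>2 + (cmod (coord y i))\<^sup>2) summable_on UNIV"
    by (intro summable_on_add ell2_summable)
  then show "(\<lambda>i. cmod (cnj (coord x i) * coord y i)) summable_on UNIV"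
  proof (rule summable_on_real_le)
    fix i
    have "2 * (cmod (coord x i) * cmod (coord y i)) \<le> (cmod (coord x i))\<^sup>2 + (cmod (coord y i))\<^sup>2"
      using sum_squares_bound[of "cmod (coord x i)" "cmod (coord y i)"] by simp
    then show "cmod (cnj (coord x i) * coord y i) \<le> (cmod (coord x i))\<^sup>2 + (cmod (coord y i))\<^sup>2"
      using mult_nonneg_nonneg[of "cmod (coord x i)" "cmod (coord y i)"]
      unfolding norm_mult complex_mod_cnj by (smt (verit) norm_ge_zero)
  qed auto
qed

lemma coord_zero [simp]: "coord 0 i = 0" by transfer simp
lemma coord_plus [simp]: "coord (x + y) i = coord x i + coord y i" by transfer simp
lemma coord_uminus [simp]: "coord (- x) i = - coord x i" by transfer simp
lemma coord_minus [simp]: "coord (x - y) i = coord x i - coord y i" by (simp only: diff_conv_add_uminus coord_plus coord_uminus)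
lemma coord_scaleC [simp]: "coord (c *\<^sub>C x) i = c * coord x i" by transfer simp

instantiation ell2 :: (type) real_vector
begin
definition scaleR_ell2 :: "real \<Rightarrow> 'a ell2 \<Rightarrow> 'a ell2" where "scaleR_ell2 r x = complex_of_real r *\<^sub>C x"
instance
proof
  fix x y :: "'a ell2" and r s :: real
  show "r *\<^sub>R (x + y) = r *\<^sub>R x + r *\<^sub>R y"
    by (rule ell2_eqI) (simp add: scaleR_ell2_def distrib_left)
  show "(r + s) *\<^sub>R x = r *\<^sub>R x + s *\<^sub>R x"
    by (rule ell2_eqI) (simp add: scaleR_ell2_def distrib_right)
  show "r *\<^sub>R s *\<^sub>R x = (r * s) *\<^sub>R x"
    by (rule ell2_eqI) (simp add: scaleR_ell2_def)
  show "1 *\<^sub>R x = x"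
    by (rule ell2_eqI) (simp add: scaleR_ell2_def)
qed
end

instantiation ell2 :: (type) real_inner
begin
definition inner_ell2 :: "'a ell2 \<Rightarrow> 'a ell2 \<Rightarrow> real" where "inner_ell2 x y = Re (cinner x y)"
definition norm_ell2 :: "'a ell2 \<Rightarrow> real" where "norm_ell2 x = sqrt (\<Sum>\<^sub>\<infinity>i. (cmod (coord x i))\<^sup>2)"
definition dist_ell2 :: "'a ell2 \<Rightarrow> 'a ell2 \<Rightarrow> real" where "dist_ell2 x y = norm (x - y)"
definition sgn_ell2 :: "'a ell2 \<Rightarrow> 'a ell2" where "sgn_ell2 x = inverse (norm x) *\<^sub>R x"
definition uniformity_ell2 :: "('a ell2 \<times> 'a ell2) filter"
  where "uniformity_ell2 = (INF e\<in>{0 <..}. principal {(x, y). dist x y < e})"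
definition open_ell2 :: "'a ell2 set \<Rightarrow> bool"
  where "open_ell2 S = (\<forall>x\<in>S. \<forall>\<^sub>F (x', y) in uniformity. x' = x \<longrightarrow> y \<in> S)"
instance
proof
  have self: "inner x x = (\<Sum>\<^sub>\<infinity>i. (cmod (coord x i))\<^sup>2)" for x :: "'a ell2"
  proof -
    have "inner x x = (\<Sum>\<^sub>\<infinity>i. Re (cnj (coord x i) * coord x i))"
      unfolding inner_ell2_def cinner_def by (rule infsum_Re[OF cinner_summable, symmetric])
    then show ?thesis unfolding cmod_power2 by (simp add: power2_eq_square)
  qed
  fix x y z :: "'a ell2" and r :: real
  show "inner x y = inner y x"
  proof -
    have "cinner x y = cnj (cinner y x)"
      unfolding cinner_def infsum_cnj[symmetric] by (simp add: mult.commute)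
    then show ?thesis by (simp add: inner_ell2_def)
  qed
  show "inner (x + y) z = inner x z + inner y z"
    unfolding inner_ell2_def cinner_def
    by (simp add: distrib_right infsum_add cinner_summable)
  show "inner (r *\<^sub>R x) y = r * inner x y"
    unfolding inner_ell2_def cinner_def scaleR_ell2_def
    by (simp add: mult.assoc infsum_cmult_right')
  show "0 \<le> inner x x"
    unfolding self by (simp add: infsum_nonneg)
  show "inner x x = 0 \<longleftrightarrow> x = 0"
  proof
    assume "inner x x = 0"
    then have "(cmod (coord x i))\<^sup>2 = 0" for i
      unfolding self by (rule nonneg_infsum_le_0D[OF eq_refl]) (auto intro: ell2_summable)
    then show "x = 0" by (intro ell2_eqI) simp
  qed (simp add: self)
  show "norm x = sqrt (inner x x)" by (simp add: norm_ell2_def self)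
  show "sgn x = x /\<^sub>R norm x" by (simp add: sgn_ell2_def)
qed (rule dist_ell2_def uniformity_ell2_def open_ell2_def)+
end

lemma norm_scaleC: "norm (c *\<^sub>C x) = cmod c * norm (x :: 'a ell2)"
  unfolding norm_ell2_def coord_scaleC norm_mult power_mult_distrib infsum_cmult_right'
  by (simp only: real_sqrt_mult real_sqrt_abs abs_norm_cancel)

lift_definition ket :: "'a \<Rightarrow> 'a ell2" is "\<lambda>a i. if i = a then 1 else 0"
  by (rule finite_nonzero_values_imp_summable_on) auto

lemma coord_ket: "coord (ket a) i = (if i = a then 1 else 0)"
  by transfer simp

lemma coord_sum: "coord (sum f F) i = (\<Sum>a\<in>F. coord (f a) i)"
  by (induction F rule: infinite_finite_induct) auto

lemma norm_ell2_sq: "(norm x)\<^sup>2 = (\<Sum>\<^sub>\<infinity>i. (cmod (coord x i))\<^sup>2)"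
  by (simp add: norm_ell2_def infsum_nonneg)

lemma sum_le_norm_ell2_sq: "finite F \<Longrightarrow> (\<Sum>i\<in>F. (cmod (coord x i))\<^sup>2) \<le> (norm x)\<^sup>2"
  unfolding norm_ell2_sq by (rule finite_sum_le_infsum) (auto intro: ell2_summable)

lemma cmod_coord_le: "cmod (coord x i) \<le> norm x"
  using sum_le_norm_ell2_sq[of "{i}" x] by (simp add: power2_le_iff_abs_le)

lemma ell2_boundI:
  fixes f :: "'a \<Rightarrow> complex"
  assumes "\<And>F. finite F \<Longrightarrow> (\<Sum>i\<in>F. (cmod (f i))\<^sup>2) \<le> B\<^sup>2" "0 \<le> B"
  shows "(\<lambda>i. (cmod (f i))\<^sup>2) summable_on UNIV" "norm (Abs_ell2 f) \<le> B"
proof -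
  show s: "(\<lambda>i. (cmod (f i))\<^sup>2) summable_on UNIV"
    by (rule nonneg_bdd_above_summable_on) (auto intro!: bdd_aboveI2 assms)
  have "(norm (Abs_ell2 f))\<^sup>2 \<le> B\<^sup>2"
    unfolding norm_ell2_sq using s
    by (simp add: Abs_ell2_inverse infsum_le_finite_sums assms)
  then show "norm (Abs_ell2 f) \<le> B" using assms(2) by (simp add: power2_le_iff_abs_le)
qed

instance ell2 :: (type) banach
proof
  fix X :: "nat \<Rightarrow> 'a ell2"
  assume X: "Cauchy X"
  have "Cauchy (\<lambda>k. coord (X k) i)" for i
  proof (rule CauchyI)
    fix e :: real assume "0 < e"
    with X obtain M where M: "\<forall>m\<ge>M. \<forall>n\<ge>M. norm (X m - X n) < e" by (meson CauchyD)
    have "norm (coord (X m) i - coord (X n) i) \<le> norm (X m - X n)" for m n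
      using cmod_coord_le[of "X m - X n" i] by simp
    with M show "\<exists>M. \<forall>m\<ge>M. \<forall>n\<ge>M. norm (coord (X m) i - coord (X n) i) < e"
      by (meson le_less_trans)
  qed
  then have "\<exists>l. (\<lambda>k. coord (X k) i) \<longlonglongrightarrow> l" for i
    using Cauchy_convergent convergent_def by blast
  then obtain f where f: "\<And>i. (\<lambda>k. coord (X k) i) \<longlonglongrightarrow> f i" by metis
  have fin: "(\<Sum>i\<in>F. (cmod (f i - coord (X m) i))\<^sup>2) \<le> e\<^sup>2"
    if F: "finite F" and M: "\<forall>n\<ge>M. norm (X n - X m) < e" for F e M m
  proof (rule tendsto_upperbound)
    show "(\<lambda>n. \<Sum>i\<in>F. (cmod (coord (X n) i - coord (X m) i))\<^sup>2) \<longlonglongrightarrow> (\<Sum>i\<in>F. (cmod (f i - coord (X m) i))\<^sup>2)"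
      by (intro tendsto_intros f)
    have "(\<Sum>i\<in>F. (cmod (coord (X n) i - coord (X m) i))\<^sup>2) \<le> e\<^sup>2" if "n \<ge> M" for n
    proof -
      have "(\<Sum>i\<in>F. (cmod (coord (X n - X m) i))\<^sup>2) \<le> (norm (X n - X m))\<^sup>2"
        by (rule sum_le_norm_ell2_sq[OF F])
      also have "\<dots> \<le> e\<^sup>2" using M that by (intro power_mono) auto
      finally show ?thesis by simp
    qed
    then show "\<forall>\<^sub>F n in sequentially. (\<Sum>i\<in>F. (cmod (coord (X n) i - coord (X m) i))\<^sup>2) \<le> e\<^sup>2"
      using eventually_sequentially by blast
  qed simp
  have key: "\<exists>M. \<forall>m\<ge>M. (\<lambda>i. (cmod (f i - coord (X m) i))\<^sup>2) summable_on UNIV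
      \<and> norm (Abs_ell2 (\<lambda>i. f i - coord (X m) i)) \<le> e" if "0 < e" for e
  proof -
    from X that obtain M where M: "\<forall>m\<ge>M. \<forall>n\<ge>M. norm (X m - X n) < e" by (meson CauchyD)
    show ?thesis
      using ell2_boundI[of "\<lambda>i. f i - coord (X m) i" e for m] fin[of _ M _ e] M that
      by (meson less_eq_real_def)
  qed
  then obtain m where "(\<lambda>i. (cmod (f i - coord (X m) i))\<^sup>2) summable_on UNIV"
    by (meson order_refl zero_less_one)
  then have d: "coord (Abs_ell2 (\<lambda>i. f i - coord (X m) i)) = (\<lambda>i. f i - coord (X m) i)"
    by (simp add: Abs_ell2_inverse)
  define x where "x = Abs_ell2 (\<lambda>i. f i - coord (X m) i) + X m"
  have x: "coord x i = f i" for i by (simp add: x_def d)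
  have "X \<longlonglongrightarrow> x"
  proof (rule LIMSEQ_I)
    fix r :: real assume "0 < r"
    then obtain M where M: "\<forall>m\<ge>M. norm (Abs_ell2 (\<lambda>i. f i - coord (X m) i)) \<le> r / 2"
      using key[of "r / 2"] by auto
    have "Abs_ell2 (\<lambda>i. f i - coord (X m) i) = x - X m" for m
    proof -
      have "coord (x - X m) = (\<lambda>i. f i - coord (X m) i)" by (simp add: fun_eq_iff x)
      then show ?thesis by (metis coord_inverse)
    qed
    with M \<open>0 < r\<close> show "\<exists>no. \<forall>n\<ge>no. norm (X n - x) < r"
      by (smt (verit) field_sum_of_halves norm_minus_commute)
  qed
  then show "convergent X" by (auto simp: convergent_def)
qed

lemma cinner_commute: "cinner x y = cnj (cinner y x)"
  unfolding cinner_def infsum_cnj[symmetric] by (simp add: mult.commute)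

lemma cinner_add_right: "cinner x (y + z) = cinner x y + cinner x z"
  unfolding cinner_def by (simp add: distrib_left infsum_add cinner_summable)

lemma cinner_scaleC_right: "cinner x (c *\<^sub>C y) = c * cinner x y"
  unfolding cinner_def by (simp add: infsum_cmult_right'[symmetric] mult_ac)

lemma cinner_ket_left: "cinner (ket i) x = coord x i"
proof -
  have "cinner (ket i) x = (\<Sum>\<^sub>\<infinity>j\<in>{i}. cnj (coord (ket i) j) * coord x j)"
    unfolding cinner_def by (rule infsum_cong_neutral) (auto simp: coord_ket)
  then show ?thesis by (simp add: coord_ket)
qed

lemma cinner_self: "cinner x x = complex_of_real ((norm x)\<^sup>2)"
proof -
  have "Im (cinner x x) = 0" using cinner_commute[of x x] by (simp add: complex_eq_iff)
  moreover have "Re (cinner x x) = (norm x)\<^sup>2"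
    by (simp add: inner_ell2_def[symmetric] power2_norm_eq_inner)
  ultimately show ?thesis by (simp add: complex_eq_iff)
qed

lemma cmod_cinner_le: "cmod (cinner x y) \<le> norm x * norm y"
proof (cases "cinner x y = 0")
  case False
  define u where "u = cnj (cinner x y) / cmod (cinner x y)"
  have "u * cinner x y = complex_of_real (cmod (cinner x y))"
    using False by (simp add: u_def field_simps complex_norm_square[symmetric] power2_eq_square)
  then have "cmod (cinner x y) = inner x (u *\<^sub>C y)"
    by (simp add: inner_ell2_def cinner_scaleC_right)
  also have "\<dots> \<le> norm x * norm (u *\<^sub>C y)" by (rule norm_cauchy_schwarz)
  also have "\<dots> = norm x * norm y" using False by (simp add: norm_scaleC u_def norm_divide)
  finally show ?thesis .
qed simp

lemma bounded_linear_cinner: "bounded_linear (cinner x)"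
  by (rule bounded_linear_intro[of _ "norm x"])
     (auto simp: cinner_add_right cinner_scaleC_right scaleR_ell2_def scaleR_conv_of_real
        mult.commute[of "norm _" "norm x"] intro: cmod_cinner_le)

lemma has_sum_ket: "((\<lambda>i. coord x i *\<^sub>C ket i) has_sum x) UNIV"
proof -
  have c: "coord (\<Sum>i\<in>F. coord x i *\<^sub>C ket i) j = (if j \<in> F then coord x j else 0)" if "finite F" for F j
    using that by (simp add: coord_sum coord_ket if_distrib[of "(*) _"] cong: if_cong)
  have n: "(norm ((\<Sum>i\<in>F. coord x i *\<^sub>C ket i) - x))\<^sup>2 = (norm x)\<^sup>2 - (\<Sum>i\<in>F. (cmod (coord x i))\<^sup>2)"
    if F: "finite F" for F
  proof -
    have "(norm ((\<Sum>i\<in>F. coord x i *\<^sub>C ket i) - x))\<^sup>2 = (\<Sum>\<^sub>\<infinity>i\<in>-F. (cmod (coord x i))\<^sup>2)"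
      unfolding norm_ell2_sq by (rule infsum_cong_neutral) (auto simp: c[OF F])
    moreover have "(norm x)\<^sup>2 = (\<Sum>\<^sub>\<infinity>i\<in>F \<union> -F. (cmod (coord x i))\<^sup>2)"
      by (simp add: norm_ell2_sq)
    moreover have "\<dots> = (\<Sum>\<^sub>\<infinity>i\<in>F. (cmod (coord x i))\<^sup>2) + (\<Sum>\<^sub>\<infinity>i\<in>-F. (cmod (coord x i))\<^sup>2)"
      by (rule infsum_Un_disjoint) (use F in \<open>auto intro: summable_on_subset[OF ell2_summable]\<close>)
    ultimately show ?thesis using F by simp
  qed
  have "((\<lambda>F. (norm x)\<^sup>2 - (\<Sum>i\<in>F. (cmod (coord x i))\<^sup>2)) \<longlongrightarrow> (norm x)\<^sup>2 - (norm x)\<^sup>2)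
      (finite_subsets_at_top UNIV)"
    unfolding norm_ell2_sq by (intro tendsto_intros infsum_tendsto ell2_summable)
  then have "((\<lambda>F. sqrt ((norm x)\<^sup>2 - (\<Sum>i\<in>F. (cmod (coord x i))\<^sup>2))) \<longlongrightarrow> 0) (finite_subsets_at_top UNIV)"
    using tendsto_real_sqrt by fastforce
  moreover have "\<forall>\<^sub>F F in finite_subsets_at_top UNIV.
      sqrt ((norm x)\<^sup>2 - (\<Sum>i\<in>F. (cmod (coord x i))\<^sup>2)) = norm ((\<Sum>i\<in>F. coord x i *\<^sub>C ket i) - x)"
    by (rule eventually_finite_subsets_at_top_weakI) (simp add: n[symmetric])
  ultimately have "((\<lambda>F. norm ((\<Sum>i\<in>F. coord x i *\<^sub>C ket i) - x)) \<longlongrightarrow> 0) (finite_subsets_at_top UNIV)"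
    by (rule Lim_transform_eventually)
  then show ?thesis
    unfolding has_sum_def by (rule LIM_zero_cancel[OF tendsto_norm_zero_cancel])
qed

section \<open>Bounded operators and von Neumann algebras\<close>

type_synonym 'a oper = "'a ell2 \<Rightarrow>\<^sub>L 'a ell2"

text \<open>The library type of bounded linear maps consists of real-linear maps, so complex
  linearity is imposed separately.\<close>

definition bounded_ops :: "'a oper set" where
  "bounded_ops = {T. \<forall>c x. blinfun_apply T (c *\<^sub>C x) = c *\<^sub>C blinfun_apply T x}"

definition adj :: "'a oper \<Rightarrow> 'a oper" where
  "adj T = (THE S. \<forall>x y. cinner (blinfun_apply S x) y = cinner x (blinfun_apply T y))"

lemma adj_exists:
  assumes "T \<in> bounded_ops"
  shows "\<exists>!S. \<forall>x y. cinner (blinfun_apply S x) y = cinner x (blinfun_apply T y)"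
proof -
  define g where "g x m = cinner (blinfun_apply T (ket m)) x" for x m
  have fin: "(\<Sum>i\<in>F. (cmod (g x i))\<^sup>2) \<le> (norm T * norm x)\<^sup>2" if F: "finite F" for F x
  proof -
    define z where "z = (\<Sum>i\<in>F. g x i *\<^sub>C ket i)"
    define Q where "Q = (\<Sum>i\<in>F. (cmod (g x i))\<^sup>2)"
    have Q: "0 \<le> Q" by (simp add: Q_def sum_nonneg)
    have "coord z j = (if j \<in> F then g x j else 0)" for j
      using F by (simp add: z_def coord_sum coord_ket if_distrib[of "(*) _"] cong: if_cong)
    then have "(norm z)\<^sup>2 = (\<Sum>\<^sub>\<infinity>i\<in>F. (cmod (g x i))\<^sup>2)"
      unfolding norm_ell2_sq by (intro infsum_cong_neutral) auto
    then have nz: "(norm z)\<^sup>2 = Q" using F by (simp add: Q_def)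
    have "blinfun_apply T z = (\<Sum>i\<in>F. g x i *\<^sub>C blinfun_apply T (ket i))"
      using assms by (simp add: z_def bounded_ops_def blinfun.sum_right)
    then have "cinner x (blinfun_apply T z) = (\<Sum>i\<in>F. g x i * cinner x (blinfun_apply T (ket i)))"
      by (simp add: bounded_linear.linear[OF bounded_linear_cinner, THEN linear_sum] cinner_scaleC_right)
    also have "\<dots> = (\<Sum>i\<in>F. g x i * cnj (g x i))"
      unfolding g_def by (simp add: cinner_commute[of x])
    also have "\<dots> = complex_of_real Q"
      by (simp add: Q_def complex_norm_square del: of_real_power)
    finally have "Q \<le> cmod (cinner x (blinfun_apply T z))"
      using Q by simp
    also have "\<dots> \<le> norm x * (norm T * norm z)"
      using cmod_cinner_le norm_blinfun by (meson mult_left_mono norm_ge_zero order_trans)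
    finally have le: "(norm z)\<^sup>2 \<le> (norm T * norm x) * norm z" by (simp add: nz mult_ac)
    have "norm z \<le> norm T * norm x"
    proof (cases "norm z = 0")
      case False
      then have "0 < norm z" by simp
      with le show ?thesis unfolding power2_eq_square by (rule mult_right_le_imp_le)
    qed simp
    then have "(norm z)\<^sup>2 \<le> (norm T * norm x)\<^sup>2" by (rule power_mono) simp
    then show ?thesis by (simp add: nz Q_def)
  qed
  define S where "S x = Abs_ell2 (g x)" for x
  note gb = ell2_boundI[OF fin, simplified]
  have S: "coord (S x) m = cinner (blinfun_apply T (ket m)) x" for x m
    using gb(1)[of x] by (simp add: S_def Abs_ell2_inverse g_def)
  have "bounded_linear S"
  proof (rule bounded_linear_intro[of _ "norm T"])
    show "norm (S x) \<le> norm x * norm T" for x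
      using gb(2)[of x] by (simp add: S_def mult.commute)
  qed (auto intro!: ell2_eqI simp: S cinner_add_right scaleR_ell2_def cinner_scaleC_right)
  then have ap: "blinfun_apply (Blinfun S) = S" by (rule bounded_linear_Blinfun_apply)
  have ad: "cinner (S x) y = cinner x (blinfun_apply T y)" for x y
  proof -
    have "((\<lambda>i. cinner x (blinfun_apply T (coord y i *\<^sub>C ket i))) has_sum cinner x (blinfun_apply T y)) UNIV"
      using has_sum_bounded_linear[OF bounded_linear_compose[OF bounded_linear_cinner blinfun.bounded_linear_right] has_sum_ket] .
    moreover have "cinner x (blinfun_apply T (coord y i *\<^sub>C ket i)) = cnj (coord (S x) i) * coord y i" for i
      using assms by (simp add: bounded_ops_def cinner_scaleC_right S cinner_commute[of x] mult.commute)
    ultimately show ?thesis by (simp add: cinner_def infsumI)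
  qed
  show ?thesis
  proof (rule ex1I[of _ "Blinfun S"])
    show "\<forall>x y. cinner (blinfun_apply (Blinfun S) x) y = cinner x (blinfun_apply T y)"
      by (simp add: ap ad)
    fix R :: "'a oper"
    assume R: "\<forall>x y. cinner (blinfun_apply R x) y = cinner x (blinfun_apply T y)"
    have "coord (blinfun_apply R x) i = coord (S x) i" for x i
    proof -
      have "cinner (ket i) (blinfun_apply R x) = cinner (ket i) (S x)"
        by (subst (1 2) cinner_commute) (simp add: R ad)
      then show ?thesis by (simp add: cinner_ket_left)
    qed
    then show "R = Blinfun S" by (intro blinfun_eqI ell2_eqI) (simp add: ap)
  qed
qed

lemma cinner_adj_left:
  "T \<in> bounded_ops \<Longrightarrow> cinner (blinfun_apply (adj T) x) y = cinner x (blinfun_apply T y)"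
  using theI'[OF adj_exists] unfolding adj_def by blast

lemma bounded_linear_scaleC: "bounded_linear ((*\<^sub>C) c :: 'a ell2 \<Rightarrow> 'a ell2)"
  by (rule bounded_linear_intro[of _ "cmod c"])
     (auto intro!: ell2_eqI simp: algebra_simps norm_scaleC scaleR_ell2_def)

definition scaleC_op :: "complex \<Rightarrow> 'a oper \<Rightarrow> 'a oper" where
  "scaleC_op c T = Blinfun (\<lambda>x. c *\<^sub>C blinfun_apply T x)"

lemma scaleC_op_apply: "blinfun_apply (scaleC_op c T) x = c *\<^sub>C blinfun_apply T x"
  unfolding scaleC_op_def
  by (simp add: bounded_linear_Blinfun_apply
      bounded_linear_compose[OF bounded_linear_scaleC blinfun.bounded_linear_right])

definition commutant :: "'a oper set \<Rightarrow> 'a oper set" where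
  "commutant S = {T \<in> bounded_ops. \<forall>R\<in>S. T o\<^sub>L R = R o\<^sub>L T}"

definition von_neumann_algebra :: "'a oper set \<Rightarrow> bool" where
  "von_neumann_algebra M \<longleftrightarrow>
     M \<subseteq> bounded_ops \<and> (\<forall>T\<in>M. adj T \<in> M) \<and> commutant (commutant M) = M"

definition vN_generated :: "'a oper set \<Rightarrow> 'a oper set" where
  "vN_generated S = \<Inter>{M. von_neumann_algebra M \<and> S \<subseteq> M}"

section \<open>The noncommutative torus\<close>

text \<open>A finite linearly ordered type \<open>'n\<close> plays the role of the index set \<open>{1, \<dots>, n}\<close>; its order
  enters the phases of the generators and the order of the factors in \<open>U\<^sup>m\<close>.\<close>

type_synonym 'n mindex = "int ^ 'n"
type_synonym 'n rmatrix = "real ^ 'n ^ 'n"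

definition torus_phase :: "'n::{finite,linorder} rmatrix \<Rightarrow> 'n \<Rightarrow> 'n mindex \<Rightarrow> complex" where
  "torus_phase \<theta> j m = cis (2 * pi * (\<Sum>l | l < j. \<theta> $ j $ l * real_of_int (m $ l)))"

lemma shift_summable:
  fixes f :: "'n::{finite,linorder} mindex \<Rightarrow> complex"
  assumes "(\<lambda>m. (cmod (f m))\<^sup>2) summable_on UNIV"
  shows "(\<lambda>m. (cmod (torus_phase \<theta> j (m - d) * f (m - d)))\<^sup>2) summable_on UNIV"
    and "(\<Sum>\<^sub>\<infinity>m. (cmod (torus_phase \<theta> j (m - d) * f (m - d)))\<^sup>2) = (\<Sum>\<^sub>\<infinity>m. (cmod (f m))\<^sup>2)"
proof -
  have b: "bij_betw (\<lambda>m. m - d) UNIV (UNIV :: 'n mindex set)"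
    by (rule bij_betw_byWitness[of _ "\<lambda>m. m + d"]) auto
  show "(\<lambda>m. (cmod (torus_phase \<theta> j (m - d) * f (m - d)))\<^sup>2) summable_on UNIV"
    using summable_on_reindex_bij_betw[OF b, of "\<lambda>m. (cmod (f m))\<^sup>2"] assms
    by (simp add: norm_mult torus_phase_def)
  show "(\<Sum>\<^sub>\<infinity>m. (cmod (torus_phase \<theta> j (m - d) * f (m - d)))\<^sup>2) = (\<Sum>\<^sub>\<infinity>m. (cmod (f m))\<^sup>2)"
    using infsum_reindex_bij_betw[OF b, of "\<lambda>m. (cmod (f m))\<^sup>2"]
    by (simp add: norm_mult torus_phase_def)
qed

lift_definition torus_U_fun :: "'n::{finite,linorder} rmatrix \<Rightarrow> 'n \<Rightarrow> 'n mindex ell2 \<Rightarrow> 'n mindex ell2"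
  is "\<lambda>\<theta> j f m. torus_phase \<theta> j (m - axis j 1) * f (m - axis j 1)"
  by (simp add: shift_summable)

lemma coord_torus_U_fun: "coord (torus_U_fun \<theta> j x) m = torus_phase \<theta> j (m - axis j 1) * coord x (m - axis j 1)"
  by transfer simp

lemma norm_torus_U_fun: "norm (torus_U_fun \<theta> j x) = norm x"
  unfolding norm_ell2_def coord_torus_U_fun by (simp add: shift_summable(2) ell2_summable)

definition torus_U :: "'n::{finite,linorder} rmatrix \<Rightarrow> 'n \<Rightarrow> 'n mindex oper" where
  "torus_U \<theta> j = Blinfun (torus_U_fun \<theta> j)"

lemma torus_U_apply: "blinfun_apply (torus_U \<theta> j) = torus_U_fun \<theta> j"
  unfolding torus_U_def
  by (intro bounded_linear_Blinfun_apply bounded_linear_intro[of _ 1])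
     (auto intro!: ell2_eqI simp: coord_torus_U_fun norm_torus_U_fun algebra_simps scaleR_ell2_def)

lemma torus_U_ket: "blinfun_apply (torus_U \<theta> j) (ket m) = torus_phase \<theta> j m *\<^sub>C ket (m + axis j 1)"
  by (rule ell2_eqI) (auto simp: torus_U_apply coord_torus_U_fun coord_ket algebra_simps)

definition nc_torus :: "'n::{finite,linorder} rmatrix \<Rightarrow> 'n mindex oper set" where
  "nc_torus \<theta> = vN_generated (range (torus_U \<theta>))"

definition op_power :: "'a oper \<Rightarrow> int \<Rightarrow> 'a oper" where
  "op_power T z = (if 0 \<le> z then ((o\<^sub>L) T ^^ nat z) id_blinfun
                   else ((o\<^sub>L) (adj T) ^^ nat (- z)) id_blinfun)"

definition torus_monomial :: "'n::{finite,linorder} rmatrix \<Rightarrow> 'n mindex \<Rightarrow> 'n mindex oper" where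
  "torus_monomial \<theta> m =
     foldr (\<lambda>j T. op_power (torus_U \<theta> j) (m $ j) o\<^sub>L T) (sorted_list_of_set UNIV) id_blinfun"

definition mi_sq :: "'n::finite mindex \<Rightarrow> real" where
  "mi_sq m = (\<Sum>j\<in>UNIV. (real_of_int (m $ j))\<^sup>2)"

definition rapidly_decreasing :: "('n::finite mindex \<Rightarrow> complex) \<Rightarrow> bool" where
  "rapidly_decreasing c \<longleftrightarrow> (\<forall>N::nat. \<exists>C. \<forall>m. (1 + mi_sq m) ^ N * cmod (c m) \<le> C)"

definition smooth_algebra :: "'n::{finite,linorder} rmatrix \<Rightarrow> 'n mindex oper set" where
  "smooth_algebra \<theta> =
     {a. \<exists>c. rapidly_decreasing c \<and> ((\<lambda>m. scaleC_op (c m) (torus_monomial \<theta> m)) has_sum a) UNIV}"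

text \<open>The canonical trace is the vector state at \<open>e\<^sub>0\<close>; as \<open>U\<^sup>m e\<^sub>0 = e\<^sub>m\<close>, it picks out the
  coefficient \<open>c\<^sub>0\<close> of \<open>\<Sum> c\<^sub>m U\<^sup>m\<close>.\<close>

definition nc_trace :: "'n::finite mindex oper \<Rightarrow> complex" where
  "nc_trace a = cinner (ket 0) (blinfun_apply a (ket 0))"

text \<open>The completion of the smooth algebra for the norm \<open>\<tau>(|a|\<^sup>2)\<^sup>1\<^sup>/\<^sup>2\<close> is realised inside
  \<open>\<ell>\<^sup>2(\<int>\<^sup>n)\<close>: by \<open>norm_cyclic_vector\<close> below, \<open>a \<mapsto> a e\<^sub>0\<close> is isometric for that norm, and the
  ambient space is complete. Under this identification, an element \<open>a\<close> of \<open>nc_torus \<theta>\<close> is the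
  vector \<open>a e\<^sub>0\<close> of \<open>nc_L2 \<theta>\<close>, and \<open>fourier \<theta> a m\<close> extends \<open>a \<mapsto> \<tau>((U\<^sup>m)\<^sup>* a)\<close>
  (\<open>fourier_cyclic_vector\<close>).\<close>

definition cyclic_vector :: "'n::finite mindex oper \<Rightarrow> 'n mindex ell2" where
  "cyclic_vector a = blinfun_apply a (ket 0)"

lemma norm_cyclic_vector:
  "a \<in> bounded_ops \<Longrightarrow> norm (cyclic_vector a) = sqrt (Re (nc_trace (adj a o\<^sub>L a)))"
proof -
  assume a: "a \<in> bounded_ops"
  have "nc_trace (adj a o\<^sub>L a) = cinner (cyclic_vector a) (cyclic_vector a)"
    unfolding nc_trace_def cyclic_vector_def
    by (subst (1 2) cinner_commute) (simp add: cinner_adj_left[OF a])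
  then show ?thesis by (simp add: cinner_self)
qed

definition nc_L2 :: "'n::{finite,linorder} rmatrix \<Rightarrow> 'n mindex ell2 set" where
  "nc_L2 \<theta> = closure (cyclic_vector ` smooth_algebra \<theta>)"

definition fourier :: "'n::{finite,linorder} rmatrix \<Rightarrow> 'n mindex ell2 \<Rightarrow> 'n mindex \<Rightarrow> complex" where
  "fourier \<theta> a m = cinner (cyclic_vector (torus_monomial \<theta> m)) a"

lemma adj_bounded_ops:
  assumes T: "T \<in> bounded_ops"
  shows "adj T \<in> bounded_ops"
proof -
  have "coord (blinfun_apply (adj T) x) i = cinner (blinfun_apply T (ket i)) x" for x i
    unfolding cinner_ket_left[symmetric]
    by (subst (1 2) cinner_commute) (simp add: cinner_adj_left[OF T])
  then show ?thesis
    by (auto simp: bounded_ops_def cinner_scaleC_right intro!: ell2_eqI)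
qed

lemma comp_bounded_ops:
  "S \<in> bounded_ops \<Longrightarrow> T \<in> bounded_ops \<Longrightarrow> S o\<^sub>L T \<in> bounded_ops"
  by (simp add: bounded_ops_def)

lemma id_bounded_ops: "id_blinfun \<in> bounded_ops"
  by (simp add: bounded_ops_def)

lemma op_power_bounded_ops:
  assumes "T \<in> bounded_ops"
  shows "op_power T z \<in> bounded_ops"
proof -
  have "((o\<^sub>L) S ^^ k) id_blinfun \<in> bounded_ops" if "S \<in> bounded_ops" for S :: "'a oper" and k
    by (induction k) (auto intro: id_bounded_ops comp_bounded_ops that)
  then show ?thesis
    unfolding op_power_def using assms adj_bounded_ops by auto
qed

lemma torus_U_bounded_ops: "torus_U \<theta> j \<in> bounded_ops"
  by (auto simp: bounded_ops_def torus_U_apply coord_torus_U_fun intro!: ell2_eqI)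

lemma torus_monomial_bounded_ops: "torus_monomial \<theta> m \<in> bounded_ops"
proof -
  have "foldr (\<lambda>j T. op_power (torus_U \<theta> j) (m $ j) o\<^sub>L T) js id_blinfun \<in> bounded_ops" for js
    by (induction js)
       (auto intro!: id_bounded_ops comp_bounded_ops op_power_bounded_ops torus_U_bounded_ops)
  then show ?thesis by (simp add: torus_monomial_def)
qed

lemma fourier_cyclic_vector:
  "fourier \<theta> (cyclic_vector a) m = nc_trace (adj (torus_monomial \<theta> m) o\<^sub>L a)"
  unfolding fourier_def nc_trace_def cyclic_vector_def
  by (subst (1 2) cinner_commute) (simp add: cinner_adj_left[OF torus_monomial_bounded_ops])

definition sobolev_term ::
  "'n::{finite,linorder} rmatrix \<Rightarrow> real \<Rightarrow> 'n mindex ell2 \<Rightarrow> 'n mindex \<Rightarrow> real" where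
  "sobolev_term \<theta> s a m = (1 + 4 * pi\<^sup>2 * mi_sq m) powr s * (cmod (fourier \<theta> a m))\<^sup>2"

definition sobolev :: "'n::{finite,linorder} rmatrix \<Rightarrow> real \<Rightarrow> 'n mindex ell2 set" where
  "sobolev \<theta> s = {a \<in> nc_L2 \<theta>. sobolev_term \<theta> s a summable_on UNIV}"

definition sobolev_norm :: "'n::{finite,linorder} rmatrix \<Rightarrow> real \<Rightarrow> 'n mindex ell2 \<Rightarrow> real" where
  "sobolev_norm \<theta> s a = sqrt (\<Sum>\<^sub>\<infinity>m. sobolev_term \<theta> s a m)"

text \<open>The operator represented by a vector of \<open>nc_L2 \<theta>\<close> is only meaningful for vectors coming from
  \<open>nc_torus \<theta>\<close>, such as those of \<open>sobolev \<theta> s\<close> with \<open>s > n/2\<close>; it is unique because \<open>e\<^sub>0\<close> is a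
  separating vector.\<close>

definition as_operator :: "'n::{finite,linorder} rmatrix \<Rightarrow> 'n mindex ell2 \<Rightarrow> 'n mindex oper" where
  "as_operator \<theta> a = (THE T. T \<in> nc_torus \<theta> \<and> cyclic_vector T = a)"

definition nc_mult ::
  "'n::{finite,linorder} rmatrix \<Rightarrow> 'n mindex ell2 \<Rightarrow> 'n mindex ell2 \<Rightarrow> 'n mindex ell2" where
  "nc_mult \<theta> a b = cyclic_vector (as_operator \<theta> a o\<^sub>L as_operator \<theta> b)"

section \<open>Banach algebras\<close>

definition is_norm_on :: "'a ell2 set \<Rightarrow> ('a ell2 \<Rightarrow> real) \<Rightarrow> bool" where
  "is_norm_on V nrm \<longleftrightarrow>
     (\<forall>x\<in>V. 0 \<le> nrm x \<and> (nrm x = 0 \<longleftrightarrow> x = 0)) \<and>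
     (\<forall>c. \<forall>x\<in>V. nrm (c *\<^sub>C x) = cmod c * nrm x) \<and>
     (\<forall>x\<in>V. \<forall>y\<in>V. nrm (x + y) \<le> nrm x + nrm y)"

definition is_complete_on :: "'a ell2 set \<Rightarrow> ('a ell2 \<Rightarrow> real) \<Rightarrow> bool" where
  "is_complete_on V nrm \<longleftrightarrow>
     (\<forall>X :: nat \<Rightarrow> 'a ell2. range X \<subseteq> V \<and>
        (\<forall>e>0. \<exists>N. \<forall>i\<ge>N. \<forall>j\<ge>N. nrm (X i - X j) < e) \<longrightarrow>
        (\<exists>x\<in>V. (\<lambda>i. nrm (X i - x)) \<longlonglongrightarrow> 0))"

definition is_algebra_on :: "'a ell2 set \<Rightarrow> ('a ell2 \<Rightarrow> 'a ell2 \<Rightarrow> 'a ell2) \<Rightarrow> bool" where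
  "is_algebra_on V mul \<longleftrightarrow>
     0 \<in> V \<and> (\<forall>x\<in>V. \<forall>y\<in>V. x + y \<in> V) \<and> (\<forall>c. \<forall>x\<in>V. c *\<^sub>C x \<in> V) \<and>
     (\<forall>x\<in>V. \<forall>y\<in>V. mul x y \<in> V) \<and>
     (\<forall>x\<in>V. \<forall>y\<in>V. \<forall>z\<in>V. mul (mul x y) z = mul x (mul y z)) \<and>
     (\<forall>x\<in>V. \<forall>y\<in>V. \<forall>z\<in>V. mul (x + y) z = mul x z + mul y z \<and> mul z (x + y) = mul z x + mul z y) \<and>
     (\<forall>c. \<forall>x\<in>V. \<forall>y\<in>V. mul (c *\<^sub>C x) y = c *\<^sub>C mul x y \<and> mul x (c *\<^sub>C y) = c *\<^sub>C mul x y)"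

text \<open>The submultiplicativity constant is not required to be 1.\<close>

definition is_banach_algebra_on ::
  "'a ell2 set \<Rightarrow> ('a ell2 \<Rightarrow> real) \<Rightarrow> ('a ell2 \<Rightarrow> 'a ell2 \<Rightarrow> 'a ell2) \<Rightarrow> bool" where
  "is_banach_algebra_on V nrm mul \<longleftrightarrow>
     is_algebra_on V mul \<and> is_norm_on V nrm \<and> is_complete_on V nrm \<and>
     (\<exists>A>0. \<forall>x\<in>V. \<forall>y\<in>V. nrm (mul x y) \<le> A * nrm x * nrm y)"

end

theory Submission
  imports Defs
begin

text \<open>An explicit computation gives \<open>U\<^sup>p e\<^sub>m = \<sigma>(p, m) e\<^bsub>p+m\<^esub>\<close> with a unimodular bicharacter \<open>\<sigma>\<close>,
  so the product is a twisted convolution of Fourier coefficients. A vector \<open>a\<close> with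
  \<open>\<Sum>\<bar>a\<^sub>p\<bar> < \<infinity>\<close> comes from the norm-convergent series \<open>\<Sum> a\<^sub>p U\<^sup>p\<close> of \<open>nc_torus \<theta>\<close>, uniquely so, because
  the right multiplications by \<open>U\<^sup>q\<close> commute with \<open>nc_torus \<theta>\<close> and have \<open>e\<^sub>0\<close> as a cyclic vector.
  For \<open>k > n/2\<close> the weights \<open>(1 + 4\<pi>\<^sup>2|m|\<^sup>2)\<^sup>-\<^sup>k\<close> are summable, so Cauchy--Schwarz puts \<open>H\<^sup>k\<close> into this
  class, and the product estimate follows from the subadditivity of
  \<open>(1 + 4\<pi>\<^sup>2|m|\<^sup>2)\<^sup>k\<^sup>/\<^sup>2\<close> up to a constant and Young's inequality \<open>\<ell>\<^sup>1 * \<ell>\<^sup>2 \<subseteq> \<ell>\<^sup>2\<close>.\<close>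

section \<open>Commutants\<close>

lemma bounded_ops_scaleC: "T \<in> bounded_ops \<Longrightarrow> blinfun_apply T (c *\<^sub>C x) = c *\<^sub>C blinfun_apply T x"
  by (simp add: bounded_ops_def)

lemma adj_unique:
  assumes "T \<in> bounded_ops" "\<And>x y. cinner (blinfun_apply S x) y = cinner x (blinfun_apply T y)"
  shows "adj T = S"
  using adj_exists[OF assms(1)] cinner_adj_left[OF assms(1)] assms(2) by blast

lemma adj_adj:
  assumes "T \<in> bounded_ops"
  shows "adj (adj T) = T"
proof (rule adj_unique[OF adj_bounded_ops[OF assms]])
  fix x y
  show "cinner (blinfun_apply T x) y = cinner x (blinfun_apply (adj T) y)"
    by (subst (1 2) cinner_commute) (simp add: cinner_adj_left[OF assms])
qed

lemma adj_comp:
  assumes "S \<in> bounded_ops" "T \<in> bounded_ops"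
  shows "adj (S o\<^sub>L T) = adj T o\<^sub>L adj S"
  by (rule adj_unique) (simp_all add: comp_bounded_ops assms cinner_adj_left)

lemma commutant_bounded: "commutant S \<subseteq> bounded_ops"
  by (auto simp: commutant_def)

lemma commutant_antimono: "S \<subseteq> T \<Longrightarrow> commutant T \<subseteq> commutant S"
  by (auto simp: commutant_def)

lemma bicommutant_incl: "S \<subseteq> bounded_ops \<Longrightarrow> S \<subseteq> commutant (commutant S)"
  by (auto simp: commutant_def)

lemma commutant_triple:
  assumes "S \<subseteq> bounded_ops"
  shows "commutant (commutant (commutant S)) = commutant S"
  using bicommutant_incl[OF commutant_bounded] commutant_antimono[OF bicommutant_incl[OF assms]]
  by blast

lemma commutant_adj_closed:
  assumes S: "S \<subseteq> bounded_ops" "\<And>R. R \<in> S \<Longrightarrow> adj R \<in> S" and T: "T \<in> commutant S"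
  shows "adj T \<in> commutant S"
proof -
  have Tb: "T \<in> bounded_ops" using T commutant_bounded by blast
  have "adj T o\<^sub>L R = R o\<^sub>L adj T" if R: "R \<in> S" for R
  proof -
    have Rb: "R \<in> bounded_ops" using R S by blast
    have "adj (T o\<^sub>L adj R) = adj (adj R o\<^sub>L T)"
      using T S(2)[OF R] by (simp add: commutant_def)
    then show ?thesis
      by (simp add: adj_comp Tb Rb adj_bounded_ops adj_adj)
  qed
  then show ?thesis by (simp add: commutant_def adj_bounded_ops Tb)
qed

lemma von_neumann_algebra_commutant:
  assumes "S \<subseteq> bounded_ops" "\<And>R. R \<in> S \<Longrightarrow> adj R \<in> S"
  shows "von_neumann_algebra (commutant S)"
  unfolding von_neumann_algebra_def
  using commutant_bounded commutant_triple commutant_adj_closed assms by blast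

lemma comp_assoc: "(A o\<^sub>L B) o\<^sub>L C = A o\<^sub>L (B o\<^sub>L C)"
  by (rule blinfun_eqI) simp

lemma commutant_comp:
  "A \<in> commutant S \<Longrightarrow> B \<in> commutant S \<Longrightarrow> A o\<^sub>L B \<in> commutant S"
  by (auto simp: commutant_def comp_bounded_ops) (metis comp_assoc)

lemma commutant_add:
  assumes "A \<in> commutant S" "B \<in> commutant S"
  shows "A + B \<in> commutant S"
proof -
  have "(A + B) \<in> bounded_ops"
    using assms by (auto simp: commutant_def bounded_ops_def blinfun.add_left intro!: ell2_eqI simp: algebra_simps)
  then show ?thesis
    using assms by (auto simp: commutant_def bounded_bilinear.add_left[OF bounded_bilinear_blinfun_compose]
        bounded_bilinear.add_right[OF bounded_bilinear_blinfun_compose])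
qed

lemma scaleC_comp_left: "scaleC_op c A o\<^sub>L R = scaleC_op c (A o\<^sub>L R)"
  by (rule blinfun_eqI) (simp add: scaleC_op_apply)

lemma scaleC_comp_right: "R \<in> bounded_ops \<Longrightarrow> R o\<^sub>L scaleC_op c A = scaleC_op c (R o\<^sub>L A)"
  by (rule blinfun_eqI) (simp add: scaleC_op_apply bounded_ops_scaleC)

lemma scaleC_op_bounded_ops: "A \<in> bounded_ops \<Longrightarrow> scaleC_op c A \<in> bounded_ops"
  by (auto simp: bounded_ops_def scaleC_op_apply intro!: ell2_eqI)

lemma commutant_scaleC:
  assumes "A \<in> commutant S" "S \<subseteq> bounded_ops"
  shows "scaleC_op c A \<in> commutant S"
  using assms by (auto simp: commutant_def scaleC_op_bounded_ops scaleC_comp_left scaleC_comp_right subset_iff)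

lemma von_neumann_algebra_closed:
  assumes "von_neumann_algebra M" "A \<in> M" "B \<in> M"
  shows "A o\<^sub>L B \<in> M" "A + B \<in> M" "scaleC_op c A \<in> M"
  using assms commutant_comp commutant_add commutant_scaleC commutant_bounded
  unfolding von_neumann_algebra_def by metis+

lemma vN_generated_closed:
  assumes "A \<in> vN_generated S" "B \<in> vN_generated S"
  shows "A o\<^sub>L B \<in> vN_generated S" "A + B \<in> vN_generated S" "scaleC_op c A \<in> vN_generated S"
  using assms von_neumann_algebra_closed unfolding vN_generated_def by blast+

lemma bounded_linear_coord: "bounded_linear (\<lambda>x. coord x i)"
  by (simp add: cinner_ket_left[symmetric] bounded_linear_cinner)

lemma norm_scaleC_op_le: "norm (scaleC_op c T) \<le> cmod c * norm T"
  by (rule norm_blinfun_bound)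
     (auto simp: scaleC_op_apply norm_scaleC mult.assoc intro!: mult_left_mono norm_blinfun)

lemma has_sum_bounded_ops:
  assumes f: "(f has_sum T) I" and b: "\<And>i. i \<in> I \<Longrightarrow> f i \<in> bounded_ops"
  shows "T \<in> bounded_ops"
proof -
  have "blinfun_apply T (c *\<^sub>C x) = c *\<^sub>C blinfun_apply T x" for c x
  proof (rule has_sum_unique)
    show "((\<lambda>i. blinfun_apply (f i) (c *\<^sub>C x)) has_sum blinfun_apply T (c *\<^sub>C x)) I"
      by (rule has_sum_bounded_linear[OF blinfun.bounded_linear_left f])
    have "((\<lambda>i. c *\<^sub>C blinfun_apply (f i) x) has_sum c *\<^sub>C blinfun_apply T x) I"
      by (rule has_sum_bounded_linear[OF bounded_linear_compose[OF bounded_linear_scaleC blinfun.bounded_linear_left] f])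
    then show "((\<lambda>i. blinfun_apply (f i) (c *\<^sub>C x)) has_sum c *\<^sub>C blinfun_apply T x) I"
      using b by (simp add: bounded_ops_scaleC cong: has_sum_cong)
  qed
  then show ?thesis by (simp add: bounded_ops_def)
qed

lemma has_sum_commutant:
  assumes f: "(f has_sum T) I" and b: "\<And>i. i \<in> I \<Longrightarrow> f i \<in> commutant S"
  shows "T \<in> commutant S"
proof -
  have "T o\<^sub>L R = R o\<^sub>L T" if R: "R \<in> S" for R
  proof (rule has_sum_unique)
    show "((\<lambda>i. f i o\<^sub>L R) has_sum (T o\<^sub>L R)) I"
      by (rule has_sum_bounded_linear[OF bounded_bilinear.bounded_linear_left[OF bounded_bilinear_blinfun_compose] f])
    have "((\<lambda>i. R o\<^sub>L f i) has_sum (R o\<^sub>L T)) I"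
      by (rule has_sum_bounded_linear[OF bounded_bilinear.bounded_linear_right[OF bounded_bilinear_blinfun_compose] f])
    then show "((\<lambda>i. f i o\<^sub>L R) has_sum (R o\<^sub>L T)) I"
      using b R by (simp add: commutant_def cong: has_sum_cong)
  qed
  moreover have "T \<in> bounded_ops"
    using has_sum_bounded_ops[OF f] b commutant_bounded by blast
  ultimately show ?thesis by (simp add: commutant_def)
qed

lemma has_sum_vN_generated:
  assumes f: "(f has_sum T) I" and b: "\<And>i. i \<in> I \<Longrightarrow> f i \<in> vN_generated S"
  shows "T \<in> vN_generated S"
  unfolding vN_generated_def
proof (intro InterI, clarify)
  fix M assume M: "von_neumann_algebra M" "S \<subseteq> M"
  then have "f i \<in> commutant (commutant M)" if "i \<in> I" for i
    using b[OF that] by (auto simp: vN_generated_def von_neumann_algebra_def)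
  then have "T \<in> commutant (commutant M)" by (rule has_sum_commutant[OF f])
  then show "T \<in> M" using M by (simp add: von_neumann_algebra_def)
qed

section \<open>Weighted shifts\<close>

lift_definition wshift_fun :: "('i::ab_group_add \<Rightarrow> real) \<Rightarrow> 'i \<Rightarrow> 'i ell2 \<Rightarrow> 'i ell2"
  is "\<lambda>\<phi> d f m. cis (\<phi> (m - d)) * f (m - d)"
proof -
  fix \<phi> :: "'i \<Rightarrow> real" and d :: 'i and f :: "'i \<Rightarrow> complex"
  assume f: "(\<lambda>i. (cmod (f i))\<^sup>2) summable_on UNIV"
  have b: "bij_betw (\<lambda>m. m - d) UNIV (UNIV :: 'i set)"
    by (rule bij_betw_byWitness[of _ "\<lambda>m. m + d"]) auto
  show "(\<lambda>m. (cmod (cis (\<phi> (m - d)) * f (m - d)))\<^sup>2) summable_on UNIV"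
    using summable_on_reindex_bij_betw[OF b, of "\<lambda>m. (cmod (f m))\<^sup>2"] f
    by (simp add: norm_mult)
qed

lemma coord_wshift_fun: "coord (wshift_fun \<phi> d x) m = cis (\<phi> (m - d)) * coord x (m - d)"
  by transfer simp

lemma norm_wshift_fun: "norm (wshift_fun \<phi> d x) = norm x"
proof -
  have b: "bij_betw (\<lambda>m. m - d) UNIV UNIV"
    by (rule bij_betw_byWitness[of _ "\<lambda>m. m + d"]) auto
  show ?thesis
    using infsum_reindex_bij_betw[OF b, of "\<lambda>m. (cmod (coord x m))\<^sup>2"]
    by (simp add: norm_ell2_def coord_wshift_fun norm_mult)
qed

definition wshift :: "('i::ab_group_add \<Rightarrow> real) \<Rightarrow> 'i \<Rightarrow> 'i oper" where
  "wshift \<phi> d = Blinfun (wshift_fun \<phi> d)"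

lemma wshift_apply: "blinfun_apply (wshift \<phi> d) = wshift_fun \<phi> d"
  unfolding wshift_def
  by (intro bounded_linear_Blinfun_apply bounded_linear_intro[of _ 1])
     (auto intro!: ell2_eqI simp: coord_wshift_fun norm_wshift_fun algebra_simps scaleR_ell2_def)

lemma coord_wshift: "coord (blinfun_apply (wshift \<phi> d) x) m = cis (\<phi> (m - d)) * coord x (m - d)"
  by (simp add: wshift_apply coord_wshift_fun)

lemma norm_wshift_le: "norm (wshift \<phi> d) \<le> 1"
  by (rule norm_blinfun_bound) (simp_all add: wshift_apply norm_wshift_fun)

lemma oper_eqI: "(\<And>x m. coord (blinfun_apply S x) m = coord (blinfun_apply T x) m) \<Longrightarrow> S = T"
  by (intro blinfun_eqI ell2_eqI)

lemma wshift_comp: "wshift \<phi> d o\<^sub>L wshift \<psi> e = wshift (\<lambda>m. \<psi> m + \<phi> (m + e)) (d + e)"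
  by (rule oper_eqI) (simp add: coord_wshift cis_mult diff_diff_eq[symmetric] add.commute flip: mult.assoc)

lemma wshift_id: "id_blinfun = wshift (\<lambda>_. 0) 0"
  by (rule oper_eqI) (simp add: coord_wshift)

lemma wshift_bounded_ops: "wshift \<phi> d \<in> bounded_ops"
  by (auto simp: bounded_ops_def coord_wshift intro!: ell2_eqI)

lemma wshift_ket: "blinfun_apply (wshift \<phi> d) (ket m) = cis (\<phi> m) *\<^sub>C ket (m + d)"
  by (rule ell2_eqI) (auto simp: coord_wshift coord_ket algebra_simps)

lemma adj_wshift: "adj (wshift \<phi> d) = wshift (\<lambda>m. - \<phi> (m - d)) (- d)"
proof (rule adj_unique[OF wshift_bounded_ops])
  fix x y :: "'a ell2"
  have b: "bij_betw (\<lambda>m. m - d) UNIV UNIV"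
    by (rule bij_betw_byWitness[of _ "\<lambda>m. m + d"]) auto
  show "cinner (blinfun_apply (wshift (\<lambda>m. - \<phi> (m - d)) (- d)) x) y
      = cinner x (blinfun_apply (wshift \<phi> d) y)"
    unfolding cinner_def coord_wshift
    by (subst infsum_reindex_bij_betw[OF b, symmetric]) (simp add: cis_cnj mult_ac)
qed

section \<open>The monomials of the noncommutative torus\<close>

definition gen_phase :: "'n::{finite,linorder} rmatrix \<Rightarrow> 'n \<Rightarrow> 'n mindex \<Rightarrow> real" where
  "gen_phase \<theta> j m = 2 * pi * (\<Sum>l | l < j. \<theta> $ j $ l * real_of_int (m $ l))"

definition mono_phase :: "'n::{finite,linorder} rmatrix \<Rightarrow> 'n mindex \<Rightarrow> 'n mindex \<Rightarrow> real" where
  "mono_phase \<theta> p m = (\<Sum>j\<in>UNIV. real_of_int (p $ j) * gen_phase \<theta> j m)"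

lemma gen_phase_add: "gen_phase \<theta> j (p + q) = gen_phase \<theta> j p + gen_phase \<theta> j q"
  by (simp add: gen_phase_def algebra_simps sum.distrib)

lemma gen_phase_upper: "(\<And>l. l < j \<Longrightarrow> q $ l = 0) \<Longrightarrow> gen_phase \<theta> j q = 0"
  by (simp add: gen_phase_def)

lemma mono_phase_add_left: "mono_phase \<theta> (p + q) m = mono_phase \<theta> p m + mono_phase \<theta> q m"
  by (simp add: mono_phase_def algebra_simps sum.distrib)

lemma mono_phase_zero [simp]: "mono_phase \<theta> p 0 = 0" "mono_phase \<theta> 0 p = 0" "mono_phase 0 p q = 0"
  by (simp_all add: mono_phase_def gen_phase_def)

lemma mono_phase_axis: "mono_phase \<theta> (axis j 1) m = gen_phase \<theta> j m"
  by (simp add: mono_phase_def axis_def if_distrib[of real_of_int] if_distrib[of "\<lambda>x. x * _"] cong: if_cong)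

lemma torus_U_wshift: "torus_U \<theta> j = wshift (gen_phase \<theta> j) (axis j 1)"
  by (rule oper_eqI) (simp add: torus_U_apply coord_torus_U_fun coord_wshift torus_phase_def gen_phase_def)

lemma gen_phase_axis: "gen_phase \<theta> j (axis j t) = 0"
  by (rule gen_phase_upper) (simp add: axis_def)

lemma axis_add: "axis j (s + t) = axis j s + (axis j t :: 'n::finite mindex)"
  by (simp add: axis_def vec_eq_iff)

lemma axis_zero_int [simp]: "axis j 0 = (0 :: 'n::finite mindex)"
  by (simp add: axis_def vec_eq_iff)

lemma axis_uminus: "axis j (- t) = - (axis j t :: 'n::finite mindex)"
  by (simp add: axis_def vec_eq_iff)

lemma wshift_funpow:
  assumes "\<And>m t. \<phi> (m + axis j t) = \<phi> m"
  shows "((o\<^sub>L) (wshift \<phi> (axis j s)) ^^ k) id_blinfun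
     = wshift (\<lambda>m. real k * \<phi> m) (axis j (int k * s) :: 'n::finite mindex)"
  by (induction k) (simp_all add: wshift_id wshift_comp assms axis_add algebra_simps)

lemma op_power_torus_U:
  "op_power (torus_U \<theta> j) z = wshift (\<lambda>m. real_of_int z * gen_phase \<theta> j m) (axis j z)"
proof -
  have inv: "gen_phase \<theta> j (m + axis j t) = gen_phase \<theta> j m" for m t
    by (simp add: gen_phase_add gen_phase_axis)
  have "gen_phase \<theta> j (m - axis j t) = gen_phase \<theta> j m" for m t
    using inv[of "m - axis j t" t] by simp
  then have adj: "adj (torus_U \<theta> j) = wshift (\<lambda>m. - gen_phase \<theta> j m) (axis j (- 1))"
    by (simp add: torus_U_wshift adj_wshift axis_uminus)
  show ?thesis
    unfolding op_power_def adj
    by (subst wshift_funpow, simp add: inv)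
       (simp add: torus_U_wshift wshift_funpow inv)
qed

lemma torus_monomial_wshift: "torus_monomial \<theta> p = wshift (mono_phase \<theta> p) p"
proof -
  have *: "foldr (\<lambda>j T. op_power (torus_U \<theta> j) (p $ j) o\<^sub>L T) js id_blinfun
      = wshift (\<lambda>m. \<Sum>j\<in>set js. real_of_int (p $ j) * gen_phase \<theta> j m) (\<Sum>j\<in>set js. axis j (p $ j))"
    if "sorted js" "distinct js" for js
    using that
  proof (induction js)
    case Nil
    show ?case by (simp add: wshift_id)
  next
    case (Cons i js)
    have "(\<Sum>j\<in>set js. axis j (p $ j)) $ l = 0" if "l < i" for l
      using that Cons.prems by (auto simp: sum_component axis_def intro!: sum.neutral)
    then have "gen_phase \<theta> i (\<Sum>j\<in>set js. axis j (p $ j)) = 0"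
      by (rule gen_phase_upper)
    then show ?case
      using Cons by (simp add: op_power_torus_U wshift_comp gen_phase_add add.commute)
  qed
  have "(\<Sum>j\<in>UNIV. axis j (p $ j)) = p"
    by (simp add: vec_eq_iff sum_component axis_def)
  then show ?thesis
    unfolding torus_monomial_def by (subst *) (simp_all add: mono_phase_def[abs_def])
qed

lemma cyclic_vector_torus_monomial: "cyclic_vector (torus_monomial \<theta> m) = ket m"
  by (rule ell2_eqI) (simp add: cyclic_vector_def torus_monomial_wshift wshift_ket)

lemma fourier_eq_coord: "fourier \<theta> a m = coord a m"
  by (simp add: fourier_def cyclic_vector_torus_monomial cinner_ket_left)

lemma gen_phase_diff: "gen_phase \<theta> j (p - q) = gen_phase \<theta> j p - gen_phase \<theta> j q"
  using gen_phase_add[of \<theta> j "p - q" q] by simp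

lemma mono_phase_diff_left: "mono_phase \<theta> (p - q) m = mono_phase \<theta> p m - mono_phase \<theta> q m"
  using mono_phase_add_left[of \<theta> "p - q" q m] by simp

text \<open>The right multiplication \<open>x \<mapsto> x U\<^sup>q\<close>.\<close>

definition right_mult :: "'n::{finite,linorder} rmatrix \<Rightarrow> 'n mindex \<Rightarrow> 'n mindex oper" where
  "right_mult \<theta> q = wshift (\<lambda>m. mono_phase \<theta> m q) q"

lemma right_mult_bounded_ops: "right_mult \<theta> q \<in> bounded_ops"
  by (simp add: right_mult_def wshift_bounded_ops)

lemma torus_U_right_mult:
  "right_mult \<theta> q o\<^sub>L torus_U \<theta> j = torus_U \<theta> j o\<^sub>L right_mult \<theta> q"
  "right_mult \<theta> q o\<^sub>L adj (torus_U \<theta> j) = adj (torus_U \<theta> j) o\<^sub>L right_mult \<theta> q"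
  unfolding right_mult_def torus_U_wshift adj_wshift wshift_comp
  by (simp_all add: gen_phase_add gen_phase_diff mono_phase_add_left mono_phase_diff_left
      mono_phase_axis algebra_simps)

lemma nc_torus_right_mult:
  assumes "T \<in> nc_torus \<theta>"
  shows "T o\<^sub>L right_mult \<theta> q = right_mult \<theta> q o\<^sub>L T"
proof -
  define S where "S = range (torus_U \<theta>) \<union> adj ` range (torus_U \<theta>)"
  have S: "S \<subseteq> bounded_ops"
    by (auto simp: S_def torus_U_bounded_ops adj_bounded_ops)
  have adjS: "adj R \<in> S" if "R \<in> S" for R
    using that by (auto simp: S_def adj_adj torus_U_bounded_ops)
  have "von_neumann_algebra (commutant (commutant S))"
    by (intro von_neumann_algebra_commutant commutant_bounded commutant_adj_closed S adjS)
  moreover have "range (torus_U \<theta>) \<subseteq> commutant (commutant S)"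
    using bicommutant_incl[OF S] by (auto simp: S_def)
  ultimately have "T \<in> commutant (commutant S)"
    using assms by (auto simp: nc_torus_def vN_generated_def)
  moreover have "right_mult \<theta> q \<in> commutant S"
    using torus_U_right_mult by (auto simp: commutant_def S_def right_mult_bounded_ops)
  ultimately show ?thesis by (simp add: commutant_def)
qed

lemma oper_eq_on_ket:
  assumes "S \<in> bounded_ops" "T \<in> bounded_ops"
    and "\<And>m. blinfun_apply S (ket m) = blinfun_apply T (ket m)"
  shows "S = T"
proof (rule blinfun_eqI, rule has_sum_unique)
  fix x
  note * = has_sum_bounded_linear[OF blinfun.bounded_linear_right has_sum_ket[of x]]
  show "((\<lambda>i. coord x i *\<^sub>C blinfun_apply T (ket i)) has_sum blinfun_apply S x) UNIV"
    using *[of S] assms by (simp add: bounded_ops_scaleC)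
  show "((\<lambda>i. coord x i *\<^sub>C blinfun_apply T (ket i)) has_sum blinfun_apply T x) UNIV"
    using *[of T] assms by (simp add: bounded_ops_scaleC)
qed

lemma nc_torus_bounded: "nc_torus \<theta> \<subseteq> bounded_ops"
proof -
  have "von_neumann_algebra bounded_ops"
    using von_neumann_algebra_commutant[of "{}"] by (simp add: commutant_def)
  then show ?thesis
    using torus_U_bounded_ops unfolding nc_torus_def vN_generated_def by blast
qed

lemma nc_torus_separating:
  assumes "S \<in> nc_torus \<theta>" "T \<in> nc_torus \<theta>" "cyclic_vector S = cyclic_vector T"
  shows "S = T"
proof (rule oper_eq_on_ket)
  show "S \<in> bounded_ops" "T \<in> bounded_ops" using assms nc_torus_bounded by blast+
  fix m
  have ket: "ket m = blinfun_apply (right_mult \<theta> m) (ket 0)"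
    by (rule ell2_eqI) (simp add: right_mult_def wshift_ket)
  have "blinfun_apply R (ket m) = blinfun_apply (right_mult \<theta> m) (cyclic_vector R)"
    if "R \<in> nc_torus \<theta>" for R
    using nc_torus_right_mult[OF that, of m] unfolding ket cyclic_vector_def
    by (metis blinfun_apply_blinfun_compose)
  then show "blinfun_apply S (ket m) = blinfun_apply T (ket m)"
    using assms by simp
qed

lemma vN_generated_adj: "A \<in> vN_generated S \<Longrightarrow> adj A \<in> vN_generated S"
  unfolding vN_generated_def von_neumann_algebra_def by blast

lemma vN_generated_id: "id_blinfun \<in> vN_generated S"
proof -
  have "id_blinfun \<in> commutant (commutant M)" for M :: "'a oper set"
    by (auto simp: commutant_def id_bounded_ops intro: blinfun_eqI)
  then show ?thesis unfolding vN_generated_def von_neumann_algebra_def by blast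
qed

lemma op_power_vN_generated:
  assumes "T \<in> vN_generated S"
  shows "op_power T z \<in> vN_generated S"
proof -
  have "((o\<^sub>L) R ^^ k) id_blinfun \<in> vN_generated S" if "R \<in> vN_generated S" for R k
    by (induction k) (auto intro: vN_generated_id vN_generated_closed that)
  then show ?thesis
    unfolding op_power_def using assms vN_generated_adj by auto
qed

lemma torus_monomial_nc_torus: "torus_monomial \<theta> m \<in> nc_torus \<theta>"
proof -
  have U: "torus_U \<theta> j \<in> vN_generated (range (torus_U \<theta>))" for j
    unfolding vN_generated_def by blast
  have "foldr (\<lambda>j T. op_power (torus_U \<theta> j) (m $ j) o\<^sub>L T) js id_blinfun \<in> nc_torus \<theta>" for js
    unfolding nc_torus_def
    by (induction js) (auto intro!: vN_generated_id vN_generated_closed op_power_vN_generated U)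
  then show ?thesis by (simp add: torus_monomial_def)
qed

section \<open>Operators with absolutely summable Fourier coefficients\<close>

definition wiener_op :: "'n::{finite,linorder} rmatrix \<Rightarrow> 'n mindex ell2 \<Rightarrow> 'n mindex oper" where
  "wiener_op \<theta> a = (\<Sum>\<^sub>\<infinity>p. scaleC_op (coord a p) (torus_monomial \<theta> p))"

lemma norm_wiener_term_le: "norm (scaleC_op c (torus_monomial \<theta> p)) \<le> cmod c"
proof -
  have "norm (scaleC_op c (torus_monomial \<theta> p)) \<le> cmod c * norm (torus_monomial \<theta> p)"
    by (rule norm_scaleC_op_le)
  also have "\<dots> \<le> cmod c * 1"
    unfolding torus_monomial_wshift by (intro mult_left_mono norm_wshift_le) simp
  finally show ?thesis by simp
qed

lemma wiener_abs_summable: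
  assumes "(\<lambda>p. cmod (coord a p)) summable_on UNIV"
  shows "(\<lambda>p. norm (scaleC_op (coord a p) (torus_monomial \<theta> p))) summable_on UNIV"
  using assms by (rule summable_on_real_le) (simp_all add: norm_wiener_term_le)

lemma has_sum_wiener_op:
  assumes "(\<lambda>p. cmod (coord a p)) summable_on UNIV"
  shows "((\<lambda>p. scaleC_op (coord a p) (torus_monomial \<theta> p)) has_sum wiener_op \<theta> a) UNIV"
  unfolding wiener_op_def
  by (rule has_sum_infsum[OF abs_summable_summable[OF wiener_abs_summable[OF assms]]])

lemma norm_wiener_op_le:
  assumes "(\<lambda>p. cmod (coord a p)) summable_on UNIV"
  shows "norm (wiener_op \<theta> a) \<le> (\<Sum>\<^sub>\<infinity>p. cmod (coord a p))"
proof -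
  have "norm (wiener_op \<theta> a) \<le> (\<Sum>\<^sub>\<infinity>p. norm (scaleC_op (coord a p) (torus_monomial \<theta> p)))"
    unfolding wiener_op_def by (rule norm_infsum_bound[OF wiener_abs_summable[OF assms]])
  also have "\<dots> \<le> (\<Sum>\<^sub>\<infinity>p. cmod (coord a p))"
    by (intro infsum_mono wiener_abs_summable assms norm_wiener_term_le)
  finally show ?thesis .
qed

lemma has_sum_coord_wiener_op:
  assumes "(\<lambda>p. cmod (coord a p)) summable_on UNIV"
  shows "((\<lambda>p. coord a p * (cis (mono_phase \<theta> p (m - p)) * coord x (m - p)))
    has_sum coord (blinfun_apply (wiener_op \<theta> a) x) m) UNIV"
proof -
  have "bounded_linear (\<lambda>T. coord (blinfun_apply T x) m)"
    by (rule bounded_linear_compose[OF bounded_linear_coord blinfun.bounded_linear_left])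
  from has_sum_bounded_linear[OF this has_sum_wiener_op[OF assms, of \<theta>]] show ?thesis
    by (simp add: scaleC_op_apply torus_monomial_wshift coord_wshift)
qed

lemma cyclic_vector_wiener_op:
  assumes "(\<lambda>p. cmod (coord a p)) summable_on UNIV"
  shows "cyclic_vector (wiener_op \<theta> a) = a"
proof (rule has_sum_unique[OF _ has_sum_ket])
  show "((\<lambda>i. coord a i *\<^sub>C ket i) has_sum cyclic_vector (wiener_op \<theta> a)) UNIV"
    using has_sum_bounded_linear[OF blinfun.bounded_linear_left has_sum_wiener_op[OF assms, of \<theta>],
        of "ket 0"] cyclic_vector_torus_monomial[of \<theta>]
    unfolding cyclic_vector_def by (simp add: scaleC_op_apply)
qed

lemma wiener_op_nc_torus:
  assumes "(\<lambda>p. cmod (coord a p)) summable_on UNIV"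
  shows "wiener_op \<theta> a \<in> nc_torus \<theta>"
  using torus_monomial_nc_torus unfolding nc_torus_def
  by (intro has_sum_vN_generated[OF has_sum_wiener_op[OF assms]] vN_generated_closed) auto

lemma as_operator_cyclic_vector:
  assumes "T \<in> nc_torus \<theta>"
  shows "as_operator \<theta> (cyclic_vector T) = T"
  unfolding as_operator_def using assms nc_torus_separating by (intro the_equality) auto

lemma as_operator_eq_wiener_op:
  assumes "(\<lambda>p. cmod (coord a p)) summable_on UNIV"
  shows "as_operator \<theta> a = wiener_op \<theta> a"
  using as_operator_cyclic_vector[OF wiener_op_nc_torus[OF assms]]
  by (simp add: cyclic_vector_wiener_op assms)

lemma nc_mult_eq:
  assumes "(\<lambda>p. cmod (coord a p)) summable_on UNIV" "(\<lambda>p. cmod (coord b p)) summable_on UNIV"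
  shows "nc_mult \<theta> a b = blinfun_apply (wiener_op \<theta> a) b"
  using cyclic_vector_wiener_op[OF assms(2)]
  by (simp add: nc_mult_def as_operator_eq_wiener_op assms cyclic_vector_def)

lemma nc_mult_cyclic_vector:
  assumes "S \<in> nc_torus \<theta>" "T \<in> nc_torus \<theta>"
  shows "nc_mult \<theta> (cyclic_vector S) (cyclic_vector T) = cyclic_vector (S o\<^sub>L T)"
  by (simp add: nc_mult_def as_operator_cyclic_vector assms)

lemma nc_torus_closed:
  "S \<in> nc_torus \<theta> \<Longrightarrow> T \<in> nc_torus \<theta> \<Longrightarrow> S o\<^sub>L T \<in> nc_torus \<theta>"
  "S \<in> nc_torus \<theta> \<Longrightarrow> T \<in> nc_torus \<theta> \<Longrightarrow> S + T \<in> nc_torus \<theta>"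
  "S \<in> nc_torus \<theta> \<Longrightarrow> scaleC_op c S \<in> nc_torus \<theta>"
  using vN_generated_closed unfolding nc_torus_def by blast+

lemma cyclic_vector_add: "cyclic_vector (S + T) = cyclic_vector S + cyclic_vector T"
  by (simp add: cyclic_vector_def blinfun.add_left)

lemma cyclic_vector_scaleC: "cyclic_vector (scaleC_op c S) = c *\<^sub>C cyclic_vector S"
  by (simp add: cyclic_vector_def scaleC_op_apply)

lemma nc_mult_bilinear:
  assumes "x \<in> cyclic_vector ` nc_torus \<theta>" "y \<in> cyclic_vector ` nc_torus \<theta>"
  shows "z \<in> cyclic_vector ` nc_torus \<theta> \<Longrightarrow> nc_mult \<theta> (x + y) z = nc_mult \<theta> x z + nc_mult \<theta> y z"
    "z \<in> cyclic_vector ` nc_torus \<theta> \<Longrightarrow> nc_mult \<theta> z (x + y) = nc_mult \<theta> z x + nc_mult \<theta> z y"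
    "nc_mult \<theta> (c *\<^sub>C x) y = c *\<^sub>C nc_mult \<theta> x y"
    "nc_mult \<theta> x (c *\<^sub>C y) = c *\<^sub>C nc_mult \<theta> x y"
  using assms nc_torus_bounded[of \<theta>]
  by (auto simp: nc_torus_closed nc_mult_cyclic_vector scaleC_comp_left scaleC_comp_right subset_iff
      bounded_bilinear.add_left[OF bounded_bilinear_blinfun_compose]
      bounded_bilinear.add_right[OF bounded_bilinear_blinfun_compose]
      simp flip: cyclic_vector_add cyclic_vector_scaleC)

lemma nc_mult_assoc:
  assumes "x \<in> cyclic_vector ` nc_torus \<theta>" "y \<in> cyclic_vector ` nc_torus \<theta>"
    "z \<in> cyclic_vector ` nc_torus \<theta>"
  shows "nc_mult \<theta> (nc_mult \<theta> x y) z = nc_mult \<theta> x (nc_mult \<theta> y z)"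
  using assms by (auto simp: nc_torus_closed nc_mult_cyclic_vector comp_assoc)

section \<open>Sobolev spaces as weighted sequence spaces\<close>

lemma mi_sq_nonneg: "0 \<le> mi_sq m"
  by (simp add: mi_sq_def sum_nonneg)

lemma nc_L2_UNIV: "nc_L2 \<theta> = UNIV"
proof -
  have fin: "(\<Sum>i\<in>F. coord x i *\<^sub>C ket i) \<in> cyclic_vector ` smooth_algebra \<theta>"
    if F: "finite F" for F and x :: "'a mindex ell2"
  proof -
    define c where "c i = (if i \<in> F then coord x i else 0)" for i
    define T where "T = (\<Sum>i\<in>F. scaleC_op (c i) (torus_monomial \<theta> i))"
    have "rapidly_decreasing c"
      unfolding rapidly_decreasing_def
    proof (intro allI exI)
      fix N :: nat and m
      show "(1 + mi_sq m) ^ N * cmod (c m) \<le> (\<Sum>i\<in>F. (1 + mi_sq i) ^ N * cmod (c i))"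
      proof (cases "m \<in> F")
        case True
        then show ?thesis
          using F by (intro member_le_sum[of m F "\<lambda>i. (1 + mi_sq i) ^ N * cmod (c i)"])
            (simp_all add: mi_sq_nonneg)
      qed (simp add: c_def sum_nonneg mi_sq_nonneg)
    qed
    moreover have "scaleC_op 0 (torus_monomial \<theta> m) = 0" for m
      by (rule oper_eqI) (simp add: scaleC_op_apply)
    then have "((\<lambda>m. scaleC_op (c m) (torus_monomial \<theta> m)) has_sum T) UNIV"
      using F by (intro has_sum_finite_neutralI[of F]) (auto simp: T_def c_def)
    ultimately have "T \<in> smooth_algebra \<theta>"
      unfolding smooth_algebra_def by blast
    moreover have "cyclic_vector T = (\<Sum>i\<in>F. coord x i *\<^sub>C ket i)"
      using cyclic_vector_torus_monomial[of \<theta>]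
      by (simp add: T_def cyclic_vector_def blinfun.sum_left scaleC_op_apply c_def)
    ultimately show ?thesis by force
  qed
  have "x \<in> nc_L2 \<theta>" for x
    unfolding nc_L2_def
  proof (rule Lim_in_closed_set)
    show "\<forall>\<^sub>F F in finite_subsets_at_top UNIV. (\<Sum>i\<in>F. coord x i *\<^sub>C ket i)
        \<in> closure (cyclic_vector ` smooth_algebra \<theta>)"
      using fin closure_subset by (intro eventually_finite_subsets_at_top_weakI) blast
    show "((\<lambda>F. \<Sum>i\<in>F. coord x i *\<^sub>C ket i) \<longlongrightarrow> x) (finite_subsets_at_top UNIV)"
      using has_sum_ket[of x] by (simp add: has_sum_def)
  qed simp_all
  then show ?thesis by blast
qed

definition sob_weight :: "real \<Rightarrow> 'n::finite mindex \<Rightarrow> real" where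
  "sob_weight s m = (1 + 4 * pi\<^sup>2 * mi_sq m) powr (s / 2)"

lemma sob_base_ge_1: "1 \<le> 1 + 4 * pi\<^sup>2 * mi_sq m"
  by (simp add: mi_sq_nonneg)

lemma sob_weight_pos: "0 < sob_weight s m"
  using sob_base_ge_1[of m] unfolding sob_weight_def by (subst powr_gt_zero) linarith

lemma sob_weight_nonneg [simp]: "0 \<le> sob_weight s m"
  by (simp add: sob_weight_pos less_imp_le)

lemma sob_weight_ge_1: "0 \<le> s \<Longrightarrow> 1 \<le> sob_weight s m"
  using sob_base_ge_1[of m] by (simp add: sob_weight_def ge_one_powr_ge_zero)

lemma sob_weight_sq: "(sob_weight s m)\<^sup>2 = (1 + 4 * pi\<^sup>2 * mi_sq m) powr s"
  by (simp add: sob_weight_def power2_eq_square flip: powr_add)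

lemma sobolev_term_eq: "sobolev_term \<theta> s a m = (sob_weight s m * cmod (coord a m))\<^sup>2"
  by (simp add: sobolev_term_def fourier_eq_coord power_mult_distrib sob_weight_sq)

lemma sobolev_iff:
  "a \<in> sobolev \<theta> s \<longleftrightarrow> (\<lambda>m. (sob_weight s m * cmod (coord a m))\<^sup>2) summable_on UNIV"
  by (simp add: sobolev_def nc_L2_UNIV sobolev_term_eq[abs_def])

definition weighted :: "real \<Rightarrow> 'n::finite mindex ell2 \<Rightarrow> 'n mindex ell2" where
  "weighted s a = Abs_ell2 (\<lambda>m. sob_weight s m * coord a m)"

lemma coord_weighted:
  "a \<in> sobolev \<theta> s \<Longrightarrow> coord (weighted s a) m = sob_weight s m * coord a m"
  by (simp add: weighted_def Abs_ell2_inverse sobolev_iff norm_mult)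

lemma sobolev_norm_weighted: "a \<in> sobolev \<theta> s \<Longrightarrow> sobolev_norm \<theta> s a = norm (weighted s a)"
  by (simp add: sobolev_norm_def norm_ell2_def sobolev_term_eq coord_weighted norm_mult)

lemma sobolev_iff_ell2:
  "a \<in> sobolev \<theta> s \<longleftrightarrow> (\<exists>y. \<forall>m. coord y m = sob_weight s m * coord a m)"
proof
  assume "\<exists>y. \<forall>m. coord y m = sob_weight s m * coord a m"
  then obtain y where y: "\<And>m. coord y m = sob_weight s m * coord a m" by blast
  show "a \<in> sobolev \<theta> s"
    using ell2_summable[of y] by (simp add: sobolev_iff y norm_mult)
qed (use coord_weighted in blast)

lemma sobolev_add: "a \<in> sobolev \<theta> s \<Longrightarrow> b \<in> sobolev \<theta> s \<Longrightarrow> a + b \<in> sobolev \<theta> s"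
  unfolding sobolev_iff_ell2 by (metis coord_plus distrib_left)

lemma sobolev_scaleC: "a \<in> sobolev \<theta> s \<Longrightarrow> c *\<^sub>C a \<in> sobolev \<theta> s"
  unfolding sobolev_iff_ell2 by (metis coord_scaleC mult.left_commute)

lemma sobolev_zero: "0 \<in> sobolev \<theta> s"
  unfolding sobolev_iff_ell2 by (rule exI[of _ 0]) simp

lemma weighted_add:
  "a \<in> sobolev \<theta> s \<Longrightarrow> b \<in> sobolev \<theta> s \<Longrightarrow> weighted s (a + b) = weighted s a + weighted s b"
  by (rule ell2_eqI) (simp add: coord_weighted[of _ \<theta>] sobolev_add distrib_left)

lemma weighted_scaleC: "a \<in> sobolev \<theta> s \<Longrightarrow> weighted s (c *\<^sub>C a) = c *\<^sub>C weighted s a"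
  by (rule ell2_eqI) (simp add: coord_weighted[of _ \<theta>] sobolev_scaleC)

lemma minus_eq_scaleC: "x - y = x + (- 1) *\<^sub>C (y :: 'i ell2)"
  by (rule ell2_eqI) simp

lemma weighted_eq_0: "a \<in> sobolev \<theta> s \<Longrightarrow> weighted s a = 0 \<longleftrightarrow> a = 0"
proof
  assume a: "a \<in> sobolev \<theta> s" "weighted s a = 0"
  show "a = 0"
  proof (rule ell2_eqI)
    fix m
    show "coord a m = coord 0 m"
      using coord_weighted[OF a(1), of m] a(2) sob_weight_pos[of s m] by simp
  qed
qed (auto intro: ell2_eqI simp: coord_weighted)

lemma weighted_surj:
  assumes "0 \<le> s"
  obtains a where "a \<in> sobolev \<theta> s" "weighted s a = y"
proof -
  let ?f = "\<lambda>m. coord y m / sob_weight s m"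
  have "(\<lambda>m. (cmod (?f m))\<^sup>2) summable_on UNIV"
  proof (rule summable_on_real_le[OF ell2_summable[of y]])
    fix m
    have "cmod (?f m) \<le> cmod (coord y m)"
      using sob_weight_ge_1[OF assms, of m]
      by (simp add: norm_divide divide_le_eq mult_le_cancel_left1)
    then show "(cmod (?f m))\<^sup>2 \<le> (cmod (coord y m))\<^sup>2" by (rule power_mono) simp
  qed simp
  then have c: "coord (Abs_ell2 ?f) m = ?f m" for m by (simp add: Abs_ell2_inverse)
  have y: "coord y m = sob_weight s m * coord (Abs_ell2 ?f) m" for m
    using sob_weight_pos[of s m] by (simp add: c)
  then have "Abs_ell2 ?f \<in> sobolev \<theta> s" unfolding sobolev_iff_ell2 by blast
  moreover from this have "weighted s (Abs_ell2 ?f) = y"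
    by (intro ell2_eqI) (simp add: coord_weighted flip: y)
  ultimately show thesis using that by blast
qed

lemma is_norm_on_sobolev: "is_norm_on (sobolev \<theta> s) (sobolev_norm \<theta> s)"
  unfolding is_norm_on_def
  by (auto simp: sobolev_norm_weighted sobolev_add sobolev_scaleC weighted_add weighted_scaleC
      weighted_eq_0 norm_scaleC norm_triangle_ineq)

lemma is_complete_on_sobolev:
  assumes "0 \<le> s"
  shows "is_complete_on (sobolev \<theta> s) (sobolev_norm \<theta> s)"
  unfolding is_complete_on_def
proof (intro allI impI, elim conjE)
  fix X :: "nat \<Rightarrow> 'a mindex ell2"
  assume X: "range X \<subseteq> sobolev \<theta> s"
    and cauchy: "\<forall>e>0. \<exists>N. \<forall>i\<ge>N. \<forall>j\<ge>N. sobolev_norm \<theta> s (X i - X j) < e"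
  have dist: "sobolev_norm \<theta> s (X i - x) = norm (weighted s (X i) - weighted s x)"
    if "x \<in> sobolev \<theta> s" for i x
  proof -
    have "X i \<in> sobolev \<theta> s" using X by blast
    then show ?thesis
      using that by (simp add: minus_eq_scaleC sobolev_norm_weighted sobolev_add sobolev_scaleC
          weighted_add weighted_scaleC)
  qed
  have "Cauchy (\<lambda>i. weighted s (X i))"
    using cauchy X dist by (intro CauchyI) (simp add: range_subsetD)
  then obtain y where y: "(\<lambda>i. weighted s (X i)) \<longlonglongrightarrow> y"
    using Cauchy_convergent convergent_def by blast
  obtain x where x: "x \<in> sobolev \<theta> s" "weighted s x = y"
    using weighted_surj[OF assms] .
  have "(\<lambda>i. sobolev_norm \<theta> s (X i - x)) \<longlonglongrightarrow> 0"
    using y x by (simp add: dist tendsto_norm_zero_iff LIM_zero_iff)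
  then show "\<exists>x\<in>sobolev \<theta> s. (\<lambda>i. sobolev_norm \<theta> s (X i - x)) \<longlonglongrightarrow> 0"
    using x by blast
qed

section \<open>Summability of the inverse weights\<close>

lemma summable_int_powr:
  assumes "t > 1 / 2"
  shows "(\<lambda>j :: int. (1 + (real_of_int j)\<^sup>2) powr (- t)) summable_on UNIV"
proof -
  have "summable (\<lambda>n. real n powr (- 2 * t))"
    using assms by (simp add: summable_real_powr_iff)
  moreover have "norm ((1 + (real n)\<^sup>2) powr (- t)) \<le> real n powr (- 2 * t)" if "1 \<le> n" for n
  proof -
    have "(1 + (real n)\<^sup>2) powr (- t) \<le> (real n powr 2) powr (- t)"
      using assms that by (intro powr_mono2') auto
    then show ?thesis by (simp only: powr_powr) simp
  qed
  ultimately have "summable (\<lambda>n. (1 + (real n)\<^sup>2) powr (- t))"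
    by (rule summable_comparison_test'[where N = 1])
  then have n: "(\<lambda>n. (1 + (real n)\<^sup>2) powr (- t)) summable_on UNIV"
    by (rule summable_nonneg_imp_summable_on) simp
  have "(\<lambda>j :: int. (1 + (real_of_int j)\<^sup>2) powr (- t)) summable_on range int"
    using n by (subst summable_on_reindex) (auto simp: o_def)
  moreover have "(\<lambda>j :: int. (1 + (real_of_int j)\<^sup>2) powr (- t)) summable_on range (\<lambda>n. - int n)"
    using n by (subst summable_on_reindex) (auto simp: o_def inj_def)
  ultimately have "(\<lambda>j :: int. (1 + (real_of_int j)\<^sup>2) powr (- t))
      summable_on (range int \<union> range (\<lambda>n. - int n))"
    by (rule summable_on_union)
  moreover have "j \<in> range int \<union> range (\<lambda>n. - int n)" for j
    by (cases j rule: int_cases2) auto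
  then have "range int \<union> range (\<lambda>n. - int n) = UNIV" by blast
  ultimately show ?thesis by simp
qed

text \<open>Each factor \<open>1 + m\<^sub>j\<^sup>2\<close> is at most \<open>1 + 4\<pi>\<^sup>2|m|\<^sup>2\<close>, so the \<open>n\<close>-dimensional sum is dominated
  by an \<open>n\<close>-fold product of one-dimensional ones.\<close>

lemma inverse_sob_weight_le_prod:
  fixes m :: "'n::finite mindex"
  assumes "0 \<le> s"
  shows "(1 / sob_weight s m)\<^sup>2 \<le> (\<Prod>j\<in>UNIV. (1 + (real_of_int (m $ j))\<^sup>2) powr (- (s / CARD('n))))"
proof -
  let ?x = "1 + 4 * pi\<^sup>2 * mi_sq m"
  have pos: "0 < ?x" using sob_base_ge_1[of m] by linarith
  have "(1 / sob_weight s m)\<^sup>2 = ?x powr (- s)"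
    by (simp add: power_divide sob_weight_sq powr_minus_divide)
  also have "\<dots> = (?x powr (- (s / CARD('n)))) ^ CARD('n)"
    using pos by (subst powr_power) auto
  also have "\<dots> = (\<Prod>j\<in>(UNIV :: 'n set). ?x powr (- (s / CARD('n))))"
    by simp
  also have "\<dots> \<le> (\<Prod>j\<in>UNIV. (1 + (real_of_int (m $ j))\<^sup>2) powr (- (s / CARD('n))))"
  proof (intro prod_mono conjI powr_mono2')
    fix j
    have "(real_of_int (m $ j))\<^sup>2 \<le> mi_sq m"
      unfolding mi_sq_def by (rule member_le_sum) auto
    also have "mi_sq m \<le> 4 * pi\<^sup>2 * mi_sq m"
    proof -
      have "1 \<le> 4 * pi\<^sup>2" using pi_ge_two power_mono[of 2 pi 2] by simp
      then show ?thesis using mult_right_mono[OF _ mi_sq_nonneg, of 1 "4 * pi\<^sup>2" m] by simp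
    qed
    finally show "1 + (real_of_int (m $ j))\<^sup>2 \<le> ?x" by simp
    show "0 < 1 + (real_of_int (m $ j))\<^sup>2" by (simp add: add_pos_nonneg)
  qed (use assms in auto)
  finally show ?thesis .
qed

lemma summable_inverse_sob_weight:
  assumes "s > CARD('n::finite) / 2"
  shows "(\<lambda>m :: 'n mindex. (1 / sob_weight s m)\<^sup>2) summable_on UNIV"
proof -
  define g where "g j = (1 + (real_of_int j)\<^sup>2) powr (- (s / CARD('n)))" for j
  have s: "0 \<le> s" using assms by (smt (verit) divide_nonneg_nonneg of_nat_0_le_iff)
  have g_nonneg: "0 \<le> g j" for j by (simp add: g_def)
  have g: "g summable_on UNIV"
    using summable_int_powr[of "s / CARD('n)"] assms
    by (simp add: g_def[abs_def] field_simps)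
  have "(\<Sum>m\<in>F. (1 / sob_weight s m)\<^sup>2) \<le> (\<Sum>\<^sub>\<infinity>j. g j) ^ CARD('n)"
    if F: "finite F" for F :: "'n mindex set"
  proof -
    define I where "I = (\<Union>m\<in>F. range (($) m))"
    have I: "finite I" using F by (auto simp: I_def)
    have "(\<Sum>m\<in>F. (1 / sob_weight s m)\<^sup>2) \<le> (\<Sum>m\<in>F. \<Prod>j\<in>UNIV. g (m $ j))"
      unfolding g_def by (intro sum_mono inverse_sob_weight_le_prod s)
    also have "\<dots> = (\<Sum>h\<in>(($) ` F). \<Prod>j\<in>UNIV. g (h j))"
      by (subst sum.reindex) (auto simp: inj_on_def vec_nth_inject)
    also have "\<dots> \<le> (\<Sum>h\<in>PiE UNIV (\<lambda>_. I). \<Prod>j\<in>(UNIV :: 'n set). g (h j))"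
      using I by (intro sum_mono2 finite_PiE prod_nonneg) (auto simp: I_def g_def)
    also have "\<dots> = (\<Prod>j\<in>(UNIV :: 'n set). \<Sum>i\<in>I. g i)"
      using I by (subst prod_sum_PiE) auto
    also have "\<dots> = (\<Sum>i\<in>I. g i) ^ CARD('n)" by simp
    also have "\<dots> \<le> (\<Sum>\<^sub>\<infinity>j. g j) ^ CARD('n)"
      using I g by (intro power_mono finite_sum_le_infsum sum_nonneg) (auto simp: g_nonneg)
    finally show ?thesis .
  qed
  then show ?thesis
    by (intro nonneg_bdd_above_summable_on bdd_aboveI2) auto
qed

definition recip_weight :: "real \<Rightarrow> 'n::finite mindex ell2" where
  "recip_weight s = Abs_ell2 (\<lambda>m. 1 / sob_weight s m)"

lemma coord_recip_weight:
  assumes "s > CARD('n::finite) / 2"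
  shows "coord (recip_weight s :: 'n mindex ell2) m = 1 / sob_weight s m"
  using summable_inverse_sob_weight[OF assms]
  by (simp add: recip_weight_def Abs_ell2_inverse norm_divide)

definition abs_ell2 :: "'i ell2 \<Rightarrow> 'i ell2" where
  "abs_ell2 x = Abs_ell2 (\<lambda>m. complex_of_real (cmod (coord x m)))"

lemma coord_abs_ell2 [simp]: "coord (abs_ell2 x) m = complex_of_real (cmod (coord x m))"
  by (simp add: abs_ell2_def Abs_ell2_inverse ell2_summable)

lemma norm_abs_ell2 [simp]: "norm (abs_ell2 x) = norm x"
  by (simp add: norm_ell2_def)

lemma sobolev_abs_summable:
  fixes a :: "'n::{finite,linorder} mindex ell2"
  assumes s: "s > CARD('n) / 2" and a: "a \<in> sobolev \<theta> s"
  shows "(\<lambda>p. cmod (coord a p)) summable_on UNIV"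
    and "(\<Sum>\<^sub>\<infinity>p. cmod (coord a p)) \<le> norm (recip_weight s :: 'n mindex ell2) * norm (weighted s a)"
proof -
  let ?c = "cinner (recip_weight s) (abs_ell2 (weighted s a))"
  have "Re (cnj (coord (recip_weight s) m) * coord (abs_ell2 (weighted s a)) m) = cmod (coord a m)" for m
    using sob_weight_pos[of s m]
    by (simp add: coord_recip_weight[OF s] coord_weighted[OF a] norm_mult)
  moreover have "((\<lambda>m. Re (cnj (coord (recip_weight s) m) * coord (abs_ell2 (weighted s a)) m)) has_sum Re ?c) UNIV"
    unfolding cinner_def by (intro has_sum_Re has_sum_infsum cinner_summable)
  ultimately have sum: "((\<lambda>m. cmod (coord a m)) has_sum Re ?c) UNIV" by simp
  then show "(\<lambda>p. cmod (coord a p)) summable_on UNIV"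
    by (rule has_sum_imp_summable)
  have "Re ?c \<le> norm (recip_weight s :: 'n mindex ell2) * norm (abs_ell2 (weighted s a))"
    using complex_Re_le_cmod cmod_cinner_le by (rule order_trans)
  then show "(\<Sum>\<^sub>\<infinity>p. cmod (coord a p)) \<le> norm (recip_weight s :: 'n mindex ell2) * norm (weighted s a)"
    by (simp add: infsumI[OF sum])
qed

lemma mi_sq_add_le: "mi_sq (p + q) \<le> 2 * mi_sq p + 2 * mi_sq q"
proof -
  have "(real_of_int x + real_of_int y)\<^sup>2 \<le> 2 * (real_of_int x)\<^sup>2 + 2 * (real_of_int y)\<^sup>2" for x y
    using sum_squares_bound[of "real_of_int x" "real_of_int y"] by (simp add: power2_sum)
  then show ?thesis
    unfolding mi_sq_def sum_distrib_left sum.distrib[symmetric] by (intro sum_mono) simp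
qed

lemma sob_weight_add_le:
  assumes "0 \<le> s"
  shows "sob_weight s (p + q) \<le> 4 powr (s / 2) * (sob_weight s p + sob_weight s q)"
proof -
  let ?w = "\<lambda>m. 1 + 4 * pi\<^sup>2 * mi_sq m"
  define M where "M = max (mi_sq p) (mi_sq q)"
  have M: "?w (p + q) \<le> 4 * (1 + 4 * pi\<^sup>2 * M)"
  proof -
    have "mi_sq (p + q) \<le> 4 * M" using mi_sq_add_le[of p q] by (simp add: M_def)
    then have "4 * pi\<^sup>2 * mi_sq (p + q) \<le> 4 * pi\<^sup>2 * (4 * M)" by (intro mult_left_mono) auto
    also have "\<dots> = 4 * (4 * pi\<^sup>2 * M)" by (simp only: mult_ac)
    finally show ?thesis unfolding distrib_left by linarith
  qed
  have "sob_weight s (p + q) \<le> (4 * (1 + 4 * pi\<^sup>2 * M)) powr (s / 2)"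
    unfolding sob_weight_def using assms sob_base_ge_1[of "p + q"] M by (intro powr_mono2) auto
  also have "\<dots> = 4 powr (s / 2) * (1 + 4 * pi\<^sup>2 * M) powr (s / 2)"
    by (rule powr_mult)
  also have "(1 + 4 * pi\<^sup>2 * M) powr (s / 2) \<le> sob_weight s p + sob_weight s q"
    by (cases "mi_sq p \<le> mi_sq q") (auto simp: M_def max_def sob_weight_def)
  finally show ?thesis by simp
qed

text \<open>Since the weight is subadditive up to a constant, the weighted Fourier coefficients of \<open>a b\<close>
  are dominated by the untwisted convolutions \<open>|b| * w|a|\<close> and \<open>|a| * w|b|\<close>. Young's inequality
  for these is the norm bound for \<open>wiener_op\<close> at \<open>\<theta> = 0\<close>, so the constant does not see \<open>\<theta>\<close>.\<close>

lemma sob_weight_wiener_op_le: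
  fixes a b :: "'n::{finite,linorder} mindex ell2"
  assumes s: "s > CARD('n) / 2" and a: "a \<in> sobolev \<theta> s" and b: "b \<in> sobolev \<theta> s"
  shows "sob_weight s m * cmod (coord (blinfun_apply (wiener_op \<theta> a) b) m)
    \<le> 4 powr (s / 2) * cmod (coord (blinfun_apply (wiener_op 0 (abs_ell2 b)) (abs_ell2 (weighted s a))
         + blinfun_apply (wiener_op 0 (abs_ell2 a)) (abs_ell2 (weighted s b))) m)"
    (is "_ \<le> ?K * cmod (coord (?X + ?Y) m)")
proof -
  have s0: "0 \<le> s" using s by (smt (verit) divide_nonneg_nonneg of_nat_0_le_iff)
  note sa = sobolev_abs_summable(1)[OF s a] and sb = sobolev_abs_summable(1)[OF s b]
  have bij: "bij_betw (\<lambda>p. m - p) UNIV (UNIV :: 'n mindex set)"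
    by (rule bij_betw_byWitness[of _ "\<lambda>p. m - p"]) auto
  have "((\<lambda>p. complex_of_real (cmod (coord b p) * (sob_weight s (m - p) * cmod (coord a (m - p)))))
      has_sum coord ?X m) UNIV"
    using has_sum_coord_wiener_op[of "abs_ell2 b" 0 m "abs_ell2 (weighted s a)"] sb
    by (simp add: coord_weighted[OF a] norm_mult)
  then have X: "((\<lambda>p. complex_of_real (cmod (coord b (m - p)) * (sob_weight s p * cmod (coord a p))))
      has_sum coord ?X m) UNIV"
    by (subst (asm) has_sum_reindex_bij_betw[OF bij, symmetric]) simp
  have Y: "((\<lambda>p. complex_of_real (cmod (coord a p) * (sob_weight s (m - p) * cmod (coord b (m - p)))))
      has_sum coord ?Y m) UNIV"
    using has_sum_coord_wiener_op[of "abs_ell2 a" 0 m "abs_ell2 (weighted s b)"] sa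
    by (simp add: coord_weighted[OF b] norm_mult)
  have g: "((\<lambda>p. ?K * (cmod (coord b (m - p)) * (sob_weight s p * cmod (coord a p))
          + cmod (coord a p) * (sob_weight s (m - p) * cmod (coord b (m - p)))))
      has_sum ?K * Re (coord (?X + ?Y) m)) UNIV"
    using has_sum_cmult_right[OF has_sum_add[OF has_sum_Re[OF X] has_sum_Re[OF Y]], of ?K] by simp
  have f: "((\<lambda>p. sob_weight s m * (coord a p * (cis (mono_phase \<theta> p (m - p)) * coord b (m - p))))
      has_sum sob_weight s m * coord (blinfun_apply (wiener_op \<theta> a) b) m) UNIV"
    by (intro has_sum_cmult_right has_sum_coord_wiener_op sa)
  have "norm (sob_weight s m * coord (blinfun_apply (wiener_op \<theta> a) b) m) \<le> ?K * Re (coord (?X + ?Y) m)"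
  proof (rule norm_infsum_le[OF f g])
    fix p
    have "sob_weight s m * (cmod (coord a p) * cmod (coord b (m - p)))
        \<le> ?K * (sob_weight s p + sob_weight s (m - p)) * (cmod (coord a p) * cmod (coord b (m - p)))"
      using sob_weight_add_le[OF s0, of p "m - p"] by (intro mult_right_mono) simp_all
    then show "norm (sob_weight s m * (coord a p * (cis (mono_phase \<theta> p (m - p)) * coord b (m - p))))
        \<le> ?K * (cmod (coord b (m - p)) * (sob_weight s p * cmod (coord a p))
          + cmod (coord a p) * (sob_weight s (m - p) * cmod (coord b (m - p))))"
      by (simp add: norm_mult algebra_simps)
  qed
  also have "\<dots> \<le> ?K * cmod (coord (?X + ?Y) m)"
    by (intro mult_left_mono complex_Re_le_cmod) simp
  finally show ?thesis by (simp add: norm_mult)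
qed

lemma ell2_dominated:
  fixes f :: "'i \<Rightarrow> real"
  assumes "\<And>m. 0 \<le> f m" "\<And>m. f m \<le> K * cmod (coord z m)" "0 \<le> K"
  shows "(\<lambda>m. (f m)\<^sup>2) summable_on UNIV" "sqrt (\<Sum>\<^sub>\<infinity>m. (f m)\<^sup>2) \<le> K * norm z"
proof -
  have le: "(f m)\<^sup>2 \<le> (cmod (coord (K *\<^sub>C z) m))\<^sup>2" for m
    using assms by (intro power_mono) (simp_all add: norm_mult)
  show sum: "(\<lambda>m. (f m)\<^sup>2) summable_on UNIV"
    by (rule summable_on_real_le[OF ell2_summable[of "K *\<^sub>C z"]]) (simp_all only: le zero_le_power2)
  have "sqrt (\<Sum>\<^sub>\<infinity>m. (f m)\<^sup>2) \<le> norm (K *\<^sub>C z)"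
    unfolding norm_ell2_def by (intro real_sqrt_le_mono infsum_mono sum ell2_summable le)
  then show "sqrt (\<Sum>\<^sub>\<infinity>m. (f m)\<^sup>2) \<le> K * norm z" using assms(3) by (simp add: norm_scaleC)
qed

lemma sobolev_nc_mult:
  fixes a b :: "'n::{finite,linorder} mindex ell2"
  assumes s: "s > CARD('n) / 2" and a: "a \<in> sobolev \<theta> s" and b: "b \<in> sobolev \<theta> s"
  shows "nc_mult \<theta> a b \<in> sobolev \<theta> s"
    and "sobolev_norm \<theta> s (nc_mult \<theta> a b)
      \<le> 4 powr (s / 2) * (2 * norm (recip_weight s :: 'n mindex ell2))
        * sobolev_norm \<theta> s a * sobolev_norm \<theta> s b"
proof -
  note sa = sobolev_abs_summable[OF s a] and sb = sobolev_abs_summable[OF s b]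
  let ?D = "norm (recip_weight s :: 'n mindex ell2)"
  let ?X = "blinfun_apply (wiener_op 0 (abs_ell2 b)) (abs_ell2 (weighted s a))"
  let ?Y = "blinfun_apply (wiener_op 0 (abs_ell2 a)) (abs_ell2 (weighted s b))"
  have conv: "norm (blinfun_apply (wiener_op 0 (abs_ell2 x)) (abs_ell2 (weighted s y)))
      \<le> ?D * norm (weighted s x) * norm (weighted s y)"
    if x: "x \<in> sobolev \<theta> s" for x y
  proof -
    have "norm (wiener_op 0 (abs_ell2 x)) \<le> ?D * norm (weighted s x)"
      using norm_wiener_op_le[of "abs_ell2 x" 0] sobolev_abs_summable[OF s x] by simp
    then show ?thesis
      using norm_blinfun[of "wiener_op 0 (abs_ell2 x)" "abs_ell2 (weighted s y)"]
      by (simp add: order_trans[OF _ mult_right_mono])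
  qed
  have "norm (?X + ?Y) \<le> 2 * ?D * norm (weighted s a) * norm (weighted s b)"
    using norm_triangle_ineq[of ?X ?Y] conv[OF a, of b] conv[OF b, of a] by (simp add: mult_ac)
  then have XY: "4 powr (s / 2) * norm (?X + ?Y)
      \<le> 4 powr (s / 2) * (2 * ?D * norm (weighted s a) * norm (weighted s b))"
    by (rule mult_left_mono) simp
  note dom = ell2_dominated[OF _ sob_weight_wiener_op_le[OF s a b]]
  show "nc_mult \<theta> a b \<in> sobolev \<theta> s"
    unfolding sobolev_iff nc_mult_eq[OF sa(1) sb(1)] by (rule dom) simp_all
  have "sobolev_norm \<theta> s (nc_mult \<theta> a b) \<le> 4 powr (s / 2) * norm (?X + ?Y)"
    unfolding sobolev_norm_def sobolev_term_eq nc_mult_eq[OF sa(1) sb(1)] by (rule dom) simp_all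
  from order_trans[OF this XY] show "sobolev_norm \<theta> s (nc_mult \<theta> a b)
      \<le> 4 powr (s / 2) * (2 * ?D) * sobolev_norm \<theta> s a * sobolev_norm \<theta> s b"
    by (simp add: sobolev_norm_weighted[OF a] sobolev_norm_weighted[OF b] mult_ac)
qed

lemma is_algebra_on_sobolev:
  assumes s: "s > CARD('n::{finite,linorder}) / 2"
  shows "is_algebra_on (sobolev \<theta> s) (nc_mult (\<theta> :: 'n rmatrix))"
proof -
  have "x \<in> cyclic_vector ` nc_torus \<theta>" if "x \<in> sobolev \<theta> s" for x
    using cyclic_vector_wiener_op wiener_op_nc_torus sobolev_abs_summable(1)[OF s that]
    by (metis image_eqI)
  then show ?thesis
    unfolding is_algebra_on_def
    by (auto simp: sobolev_zero sobolev_add sobolev_scaleC sobolev_nc_mult[OF s] nc_mult_bilinear nc_mult_assoc)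
qed

theorem proposition4p2:
  fixes k :: nat
  assumes "k \<ge> 1" and "real k > real CARD('n::{finite,linorder}) / 2"
  shows "\<exists>A>0. \<forall>\<theta> :: 'n rmatrix. transpose \<theta> = - \<theta> \<longrightarrow>
           is_banach_algebra_on (sobolev \<theta> (real k)) (sobolev_norm \<theta> (real k)) (nc_mult \<theta>) \<and>
           (\<forall>a \<in> sobolev \<theta> (real k). \<forall>b \<in> sobolev \<theta> (real k).
              sobolev_norm \<theta> (real k) (nc_mult \<theta> a b)
                \<le> A * sobolev_norm \<theta> (real k) a * sobolev_norm \<theta> (real k) b)"
proof -
  define A where "A = 4 powr (real k / 2) * (2 * norm (recip_weight k :: 'n mindex ell2))"
  have "coord (recip_weight k :: 'n mindex ell2) 0 \<noteq> 0"
    using less_imp_neq[OF sob_weight_pos[of k "0 :: 'n mindex"]] by (subst coord_recip_weight[OF assms(2)]) simp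
  then have "(recip_weight k :: 'n mindex ell2) \<noteq> 0" by auto
  then have A: "0 < A" by (simp add: A_def)
  have "sobolev_norm \<theta> k (nc_mult \<theta> a b) \<le> A * sobolev_norm \<theta> k a * sobolev_norm \<theta> k b"
    if "a \<in> sobolev \<theta> k" "b \<in> sobolev \<theta> k" for \<theta> :: "'n rmatrix" and a b
    using sobolev_nc_mult(2)[OF assms(2) that] by (simp add: A_def)
  then show ?thesis
    using A is_algebra_on_sobolev[OF assms(2)] is_norm_on_sobolev is_complete_on_sobolev[of "real k"]
    unfolding is_banach_algebra_on_def by (intro exI[of _ A]) auto
qed

end
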